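(* Let $Q$ be a finite acyclic quiver whose underlying undirected graph is connected. Then the sequences $(a(v,n))_{n\ge 0}$, $v$ a vertex of $Q$, of the frieze associated to $Q$ are either all bounded or all unbounded. Suppose moreover that the frieze is rational. If the sequences are all bounded (resp. all unbounded), then the underlying undirected graph of $Q$ is a Dynkin diagram (resp. an extended Dynkin diagram), so that $Q$ is a Dynkin diagram (resp. an extended Dynkin diagram) with some acyclic orientation.
   Context: A quiver is a directed graph (multiple arrows are allowed); it is acyclic if it has no directed cycle (in particular no loops). Let $Q$ be a finite acyclic quiver with vertex set $V$. The frieze associated to $Q$ is the family of sequences $(a(v,n))_{n\ge 0}$, one for each $v\in V$, defined by $a(v,0)=1$ and $$a(v,n+1)=\frac{1+\prod_{w\to v}a(w,n+1)\prod_{v\to w}a(w,n)}{a(v,n)},$$ where the products run over the arrows of $Q$ ending at $v$, respectively starting at $v$, counted with multiplicity. Acyclicity guarantees existence and uniqueness of these sequences of positive rational numbers (they are in fact positive integers). A sequence $(a_n)_{n\ge0}$ is rational if it satisfies a linear recursion with constant coefficients, i.e. there are $d\ge1$ and constants $\alpha_1,\dots,\alpha_d$ with $a_{n+d}=\alpha_1a_{n+d-1}+\cdots+\alpha_d a_n$ for all $n\ge 0$; equivalently $\sum a_nx^n$ is the expansion of a rational function. The frieze is rational if all its sequences are rational. Dynkin diagrams (undirected graphs): $\mathbb A_n$ ($n\ge1$, path with $n$ vertices); $\mathbb D_n$ ($n\ge4$, $n$ vertices, a tree with one vertex of degree 3 and three arms having $1,1,n-3$ further vertices); $\mathbb E_6,\mathbb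 E_7,\mathbb E_8$ (trees with one vertex of degree 3 and three arms having respectively $(1,2,2)$, $(1,2,3)$, $(1,2,4)$ further vertices). Extended Dynkin diagrams: $\widetilde{\mathbb A}_n$ ($n\ge1$, cycle with $n+1$ vertices; for $n=1$ two vertices joined by a double edge); $\widetilde{\mathbb D}_n$ ($n\ge 4$, $n+1$ vertices: a path with $n-3$ vertices with two extra leaves attached at each of its two ends; for $n=4$ this is one vertex with four leaves); $\widetilde{\mathbb E}_6,\widetilde{\mathbb E}_7,\widetilde{\mathbb E}_8$ (trees with one vertex of degree 3 and three arms having respectively $(2,2,2)$, $(1,3,3)$, $(1,2,5)$ further vertices). *)

theory Defs
  imports Complex_Main "HOL-Library.Multiset" "Graph_Theory.Graph_Theory"
begin

section \<open>Quivers and friezes\<close>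

text \<open>Loops and 2-cycles are cycles in the sense of \<^const>\<open>pre_digraph.cycle\<close>.\<close>

locale acyclic_quiver = fin_digraph Q for Q :: "('v, 'e) pre_digraph" (structure) +
  assumes no_cycle: "\<not> (\<exists>p. cycle p)"

text \<open>
  For an acyclic quiver, the values \<open>a v n\<close> with \<open>v \<in> verts Q\<close> are uniquely determined by this
  predicate, they exist, and they are positive; see \<open>frieze_unique\<close>, \<open>frieze_exists\<close> and
  \<open>frieze_pos\<close> below. In particular there is never a division by zero.
\<close>

definition is_frieze :: "('v, 'e) pre_digraph \<Rightarrow> ('v \<Rightarrow> nat \<Rightarrow> real) \<Rightarrow> bool" where
  "is_frieze Q a \<longleftrightarrow>
     (\<forall>v\<in>verts Q. a v 0 = 1 \<and>
       (\<forall>n. a v (n + 1) =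
          (1 + (\<Prod>e\<in>in_arcs Q v. a (tail Q e) (n + 1)) * (\<Prod>e\<in>out_arcs Q v. a (head Q e) n))
          / a v n))"

definition rational_seq :: "(nat \<Rightarrow> real) \<Rightarrow> bool" where
  "rational_seq s \<longleftrightarrow>
     (\<exists>d \<ge> 1. \<exists>\<alpha> :: nat \<Rightarrow> real. \<forall>n. s (n + d) = (\<Sum>i = 1..d. \<alpha> i * s (n + d - i)))"

definition rational_frieze :: "('v, 'e) pre_digraph \<Rightarrow> ('v \<Rightarrow> nat \<Rightarrow> real) \<Rightarrow> bool" where
  "rational_frieze Q a \<longleftrightarrow> (\<forall>v\<in>verts Q. rational_seq (a v))"

context acyclic_quiver
begin

lemma wf_frieze_order: "wf (less_than <*lex*> arcs_ends Q)"
proof -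
  have "acyclic (arcs_ends Q)"
  proof (rule acyclicI, rule allI, rule notI)
    fix v assume "(v, v) \<in> (arcs_ends Q)\<^sup>+"
    then obtain p where "awalk v p v" "p \<noteq> []"
      using reachable1_awalk by blast
    then have "closed_w p" unfolding closed_w_def by blast
    then show False using closed_w_imp_cycle no_cycle by blast
  qed
  moreover have "finite (arcs_ends Q)" by (simp add: arcs_ends_def)
  ultimately show ?thesis by (intro wf_lex_prod wf_less_than finite_acyclic_wf)
qed

lemma frieze_order_in:
  "e \<in> in_arcs Q v \<Longrightarrow> ((n, tail Q e), (n, v)) \<in> less_than <*lex*> arcs_ends Q"
  by (auto simp: arcs_ends_conv)

lemma frieze_exists: "\<exists>a. is_frieze Q a"
proof -
  define r where "r = less_than <*lex*> arcs_ends Q"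
  define F :: "(nat \<times> 'v \<Rightarrow> real) \<Rightarrow> nat \<times> 'v \<Rightarrow> real" where
    "F = (\<lambda>f (n, v). case n of 0 \<Rightarrow> 1 | Suc m \<Rightarrow>
       (1 + (\<Prod>e\<in>in_arcs Q v. f (n, tail Q e)) * (\<Prod>e\<in>out_arcs Q v. f (m, head Q e))) / f (m, v))"
  define f where "f = wfrec r F"
  have f: "f x = F (cut f r x) x" for x
    unfolding f_def by (rule wfrec) (simp only: r_def wf_frieze_order)
  have "(\<Prod>e\<in>in_arcs Q v. cut f r (Suc m, v) (Suc m, tail Q e))
      = (\<Prod>e\<in>in_arcs Q v. f (Suc m, tail Q e))" for m v
    unfolding r_def by (rule prod.cong[OF refl], rule cut_apply, erule frieze_order_in)
  moreover have "cut f r (Suc m, v) (m, w) = f (m, w)" for m v w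
    by (simp add: cut_apply r_def)
  ultimately have "f (Suc m, v) = (1 + (\<Prod>e\<in>in_arcs Q v. f (Suc m, tail Q e))
      * (\<Prod>e\<in>out_arcs Q v. f (m, head Q e))) / f (m, v)" for m v
    by (subst f[of "(Suc m, v)"]) (simp add: F_def)
  moreover have "f (0, v) = 1" for v by (subst f[of "(0, v)"]) (simp add: F_def)
  ultimately have "is_frieze Q (\<lambda>v n. f (n, v))"
    unfolding is_frieze_def Suc_eq_plus1[symmetric] by blast
  then show ?thesis by blast
qed

lemma frieze_0: "is_frieze Q a \<Longrightarrow> v \<in> verts Q \<Longrightarrow> a v 0 = 1"
  unfolding is_frieze_def by blast

lemma frieze_step:
  assumes "is_frieze Q a" "v \<in> verts Q"
  shows "a v (Suc n) = (1 + (\<Prod>e\<in>in_arcs Q v. a (tail Q e) (Suc n))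
           * (\<Prod>e\<in>out_arcs Q v. a (head Q e) n)) / a v n"
  using assms unfolding is_frieze_def Suc_eq_plus1[symmetric] by blast

lemma frieze_unique:
  assumes "is_frieze Q a" "is_frieze Q b" "v \<in> verts Q"
  shows "a v n = b v n"
proof -
  have "snd x \<in> verts Q \<longrightarrow> a (snd x) (fst x) = b (snd x) (fst x)" for x
  proof (induction x rule: wf_induct_rule[OF wf_frieze_order])
    case (1 x)
    obtain n v where x: "x = (n, v)" by fastforce
    show ?case
    proof (cases n)
      case 0
      then show ?thesis using assms x by (simp add: frieze_0)
    next
      case (Suc m)
      have "a v n = b v n" if v: "v \<in> verts Q"
      proof -
        have "(\<Prod>e\<in>in_arcs Q v. a (tail Q e) n) = (\<Prod>e\<in>in_arcs Q v. b (tail Q e) n)"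
          using 1[of "(n, tail Q e)" for e] frieze_order_in x by (intro prod.cong) auto
        moreover have "(\<Prod>e\<in>out_arcs Q v. a (head Q e) m) = (\<Prod>e\<in>out_arcs Q v. b (head Q e) m)"
          using 1[of "(m, head Q e)" for e] Suc x by (intro prod.cong) auto
        moreover have "a v m = b v m" using 1[of "(m, v)"] Suc x v by auto
        ultimately show ?thesis
          using frieze_step[OF assms(1) v] frieze_step[OF assms(2) v] Suc by simp
      qed
      then show ?thesis using x by simp
    qed
  qed
  from this[of "(n, v)"] show ?thesis using assms by simp
qed

lemma frieze_pos:
  assumes "is_frieze Q a" "v \<in> verts Q"
  shows "0 < a v n"
proof -
  have "snd x \<in> verts Q \<longrightarrow> 0 < a (snd x) (fst x)" for x
  proof (induction x rule: wf_induct_rule[OF wf_frieze_order])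
    case (1 x)
    obtain n v where x: "x = (n, v)" by fastforce
    show ?case
    proof (cases n)
      case 0
      then show ?thesis using assms x by (simp add: frieze_0)
    next
      case (Suc m)
      have "0 < a v n" if v: "v \<in> verts Q"
      proof -
        have "0 < (\<Prod>e\<in>in_arcs Q v. a (tail Q e) n)"
          using 1[of "(n, tail Q e)" for e] frieze_order_in x by (intro prod_pos) auto
        moreover have "0 < (\<Prod>e\<in>out_arcs Q v. a (head Q e) m)"
          using 1[of "(m, head Q e)" for e] Suc x by (intro prod_pos) auto
        moreover have "0 < a v m" using 1[of "(m, v)"] Suc x v by auto
        ultimately show ?thesis
          using frieze_step[OF assms(1) v] Suc by (simp add: add_pos_pos)
      qed
      then show ?thesis using x by simp
    qed
  qed
  from this[of "(n, v)"] show ?thesis using assms by simp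
qed

end


section \<open>Undirected multigraphs and diagrams\<close>

text \<open>
  An undirected multigraph is a pair of a vertex set and a multiset of edges, an edge being the set
  of its end vertices.
\<close>

type_synonym 'v multigraph = "'v set \<times> 'v set multiset"

definition underlying_graph :: "('v, 'e) pre_digraph \<Rightarrow> 'v multigraph" where
  "underlying_graph Q = (verts Q, {# {tail Q e, head Q e}. e \<in># mset_set (arcs Q) #})"

definition multigraph_iso :: "'v multigraph \<Rightarrow> 'w multigraph \<Rightarrow> bool" (infix "\<cong>\<^sub>M" 50) where
  "G \<cong>\<^sub>M H \<longleftrightarrow> (\<exists>f. bij_betw f (fst G) (fst H) \<and> {# f ` E. E \<in># snd G #} = snd H)"

definition path_diagram :: "nat \<Rightarrow> nat multigraph" where
  "path_diagram n = ({..<n}, {# {i, i + 1}. i \<in># mset_set {..<n - 1} #})"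

text \<open>For \<open>n = 2\<close> this has the edge \<open>{0, 1}\<close> twice.\<close>

definition cycle_diagram :: "nat \<Rightarrow> nat multigraph" where
  "cycle_diagram n = ({..<n}, {# {i, (i + 1) mod n}. i \<in># mset_set {..<n} #})"

text \<open>
  Arms of lengths \<open>ls ! 0, ls ! 1, \<dots>\<close> attached to one central vertex. Vertex \<open>j\<close> of arm \<open>i\<close> has
  distance \<open>j\<close> from the centre, so that for \<open>j = 0\<close> it is the centre, independently of \<open>i\<close>.
\<close>

definition arm_vertex :: "nat \<Rightarrow> nat \<Rightarrow> nat \<times> nat" where
  "arm_vertex i j = (if j = 0 then (0, 0) else (i, j))"

definition star_diagram :: "nat list \<Rightarrow> (nat \<times> nat) multigraph" where
  "star_diagram ls =
     ({arm_vertex i j | i j. i < length ls \<and> j \<le> ls ! i},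
      {# {arm_vertex i j, arm_vertex i (j + 1)}.
           (i, j) \<in># mset_set (SIGMA i:{..<length ls}. {..<ls ! i}) #})"

text \<open>
  A path with the \<open>n - 3\<close> vertices \<open>0, \<dots>, n - 4\<close>, the leaves \<open>n - 3\<close> and \<open>n - 2\<close> attached to the
  first of them and the leaves \<open>n - 1\<close> and \<open>n\<close> attached to the last. Meaningful for \<open>n \<ge> 4\<close>.
\<close>

definition extended_D_diagram :: "nat \<Rightarrow> nat multigraph" where
  "extended_D_diagram n =
     ({..n},
      {# {i, i + 1}. i \<in># mset_set {..<n - 4} #}
      + {# {0, n - 3}, {0, n - 2}, {n - 4, n - 1}, {n - 4, n} #})"

definition dynkin_diagram :: "'v multigraph \<Rightarrow> bool" where
  "dynkin_diagram G \<longleftrightarrow>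
     (\<exists>n\<ge>1. G \<cong>\<^sub>M path_diagram n)
     \<or> (\<exists>n\<ge>4. G \<cong>\<^sub>M star_diagram [1, 1, n - 3])
     \<or> G \<cong>\<^sub>M star_diagram [1, 2, 2]
     \<or> G \<cong>\<^sub>M star_diagram [1, 2, 3]
     \<or> G \<cong>\<^sub>M star_diagram [1, 2, 4]"

definition extended_dynkin_diagram :: "'v multigraph \<Rightarrow> bool" where
  "extended_dynkin_diagram G \<longleftrightarrow>
     (\<exists>n\<ge>1. G \<cong>\<^sub>M cycle_diagram (n + 1))
     \<or> (\<exists>n\<ge>4. G \<cong>\<^sub>M extended_D_diagram n)
     \<or> G \<cong>\<^sub>M star_diagram [2, 2, 2]
     \<or> G \<cong>\<^sub>M star_diagram [1, 3, 3]
     \<or> G \<cong>\<^sub>M star_diagram [1, 2, 5]"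

end

theory Submission
  imports Defs
begin

text \<open>
  The proof reads the exchange relation \<open>a v (n + 1) * a v n = 1 + M\<close> logarithmically. Write \<open>A\<close> for the
  adjacency matrix of the underlying graph and let \<open>S v N\<close> be the sum of \<open>ln (a v n)\<close> over \<open>n < N\<close>.
  Summing the relation gives \<open>(2 - A) S = E + boundary terms\<close>, where \<open>E\<close> collects the errors
  \<open>ln (1 + 1 / M) > 0\<close> (\<open>cartan_sum_ln_frieze\<close>).

  Frieze values are integers, by an elementary congruence argument for acyclic quivers
  (\<open>frieze_Ints_step\<close>); hence they are at least \<open>1\<close>, and a bound at one vertex gives one at each
  neighbour. So boundedness spreads over the connected quiver.

  If all sequences are bounded, \<open>E\<close> grows linearly while the boundary stays bounded, and some \<open>S\<close> is
  a non-negative function with \<open>(2 - A) S > 0\<close>. If they are unbounded and rational, then \<open>E\<close> and the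
  boundary are \<open>O(N)\<close> because a linear recurrence allows only exponential growth, whereas \<open>S v N / N\<close>
  tends to infinity: an integral linear recurrent sequence that returned infinitely often to a window
  of small values would be periodic. After rescaling, this gives arbitrarily large functions \<open>f\<close> with
  \<open>\<bar>(2 - A) f\<bar> \<le> 1\<close>.

  The rest is about graphs. As \<open>2 - A\<close> is self-adjoint, both situations can be tested against a
  non-negative function \<open>g\<close> of our choice (\<open>sum_extend_zero_mult_cartan\<close>). If the graph contains a cycle
  or two branchings joined by a path, \<open>g\<close> is the additive function of the corresponding diagram of type
  \<open>A\<close> or \<open>D\<close> (\<open>additive_embedding\<close>): the first situation is impossible, and in the second the diagram
  is the whole graph. Otherwise the graph is a star with at most three arms
  (\<open>extended_or_spanning_tripod\<close>). There \<open>g\<close> decreases linearly along the arms, and \<open>(2 - A) g\<close> vanishes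
  except at the centre, where it is \<open>1 / p + 1 / q + 1 / r - 1\<close> for arms with \<open>p - 1\<close>, \<open>q - 1\<close> and \<open>r - 1\<close>
  vertices (\<open>star_form\<close>). The first situation forces this number to be positive, the second forces it
  to be \<open>0\<close>, and the solutions of these conditions are the Dynkin and the remaining extended Dynkin diagrams.
\<close>

section \<open>Recurrent sequences of positive integers\<close>

lemma rational_seq_exponential_bound:
  assumes "rational_seq s"
  shows "\<exists>C\<ge>1. \<exists>B\<ge>1. \<forall>n. \<bar>s n\<bar> \<le> C * B ^ n"
proof -
  obtain d \<alpha> where d: "d \<ge> 1" and rec: "\<And>n. s (n + d) = (\<Sum>i = 1..d. \<alpha> i * s (n + d - i))"
    using assms unfolding rational_seq_def by blast
  define B where "B = 1 + (\<Sum>i = 1..d. \<bar>\<alpha> i\<bar>)"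
  define C where "C = 1 + (\<Sum>i<d. \<bar>s i\<bar>)"
  have B: "B \<ge> 1" unfolding B_def by (simp add: sum_nonneg)
  have C: "C \<ge> 1" unfolding C_def by (simp add: sum_nonneg)
  have "\<bar>s n\<bar> \<le> C * B ^ n" for n
  proof (induction n rule: less_induct)
    case (less n)
    show ?case
    proof (cases "n < d")
      case True
      have "\<bar>s n\<bar> \<le> (\<Sum>i<d. \<bar>s i\<bar>)" using True by (intro member_le_sum) auto
      also have "\<dots> \<le> C * 1" by (simp add: C_def)
      also have "\<dots> \<le> C * B ^ n" using B C by (intro mult_left_mono one_le_power) auto
      finally show ?thesis .
    next
      case False
      then obtain m where n: "n = m + d" by (metis add.commute le_Suc_ex not_less)
      have "\<bar>s n\<bar> \<le> (\<Sum>i = 1..d. \<bar>\<alpha> i * s (n - i)\<bar>)" unfolding n rec by (rule sum_abs)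
      also have "\<dots> \<le> (\<Sum>i = 1..d. \<bar>\<alpha> i\<bar> * (C * B ^ (n - 1)))"
      proof (rule sum_mono)
        fix i assume i: "i \<in> {1..d}"
        then have "\<bar>s (n - i)\<bar> \<le> C * B ^ (n - i)" using n by (intro less) auto
        also have "\<dots> \<le> C * B ^ (n - 1)"
          using B C i by (intro mult_left_mono power_increasing) auto
        finally show "\<bar>\<alpha> i * s (n - i)\<bar> \<le> \<bar>\<alpha> i\<bar> * (C * B ^ (n - 1))"
          unfolding abs_mult by (intro mult_left_mono) auto
      qed
      also have "\<dots> = (B - 1) * (C * B ^ (n - 1))" by (simp add: B_def sum_distrib_right)
      also have "\<dots> \<le> B * (C * B ^ (n - 1))" using B C by (intro mult_right_mono) auto
      also have "\<dots> = C * B ^ n" using d n by (simp add: power_eq_if)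
      finally show ?thesis .
    qed
  qed
  then show ?thesis using B C by blast
qed

text \<open>
  A recurrence of order \<open>d\<close> is determined by any window of \<open>d\<close> consecutive values. There are only
  finitely many windows with integer entries from a bounded range, so if windows below \<open>C\<close> kept
  occurring, one would repeat and the sequence would be periodic from there on.
\<close>
lemma unbounded_rational_seq_windows:
  assumes rat: "rational_seq s" and int: "\<And>n. s n \<in> \<int>" and unb: "\<not> Bseq s"
  shows "\<exists>d\<ge>1. \<forall>C. \<exists>n0. \<forall>n\<ge>n0. \<exists>i<d. \<bar>s (n + i)\<bar> > C"
proof -
  obtain d \<alpha> where d: "d \<ge> 1" and rec: "\<And>n. s (n + d) = (\<Sum>i = 1..d. \<alpha> i * s (n + d - i))"
    using rat unfolding rational_seq_def by blast
  have "\<exists>n0. \<forall>n\<ge>n0. \<exists>i<d. \<bar>s (n + i)\<bar> > C" for C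
  proof (rule ccontr)
    define W where "W = {n. \<forall>i<d. \<bar>s (n + i)\<bar> \<le> C}"
    define w where "w n = map (\<lambda>i. s (n + i)) [0..<d]" for n
    assume "\<not> ?thesis"
    then have "\<exists>n\<ge>m. n \<in> W" for m unfolding W_def by (auto simp: not_less[of C])
    then have "infinite W" unfolding infinite_nat_iff_unbounded_le by blast
    have "finite {x :: real. x \<in> \<int> \<and> \<bar>x\<bar> \<le> C}" by (rule finite_abs_int_segment)
    then have "finite {xs :: real list. set xs \<subseteq> {x. x \<in> \<int> \<and> \<bar>x\<bar> \<le> C} \<and> length xs = d}"
      by (rule finite_lists_length_eq)
    moreover have "w ` W \<subseteq> {xs. set xs \<subseteq> {x. x \<in> \<int> \<and> \<bar>x\<bar> \<le> C} \<and> length xs = d}"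
      using int by (auto simp: w_def W_def)
    ultimately have "finite (w ` W)" by (rule finite_subset[rotated])
    then have "\<not> inj_on w W" using \<open>infinite W\<close> finite_imageD by blast
    then obtain m m' where mm: "m < m'" "w m = w m'"
      unfolding inj_on_def by (metis linorder_neqE_nat)
    have per: "s (m + k) = s (m' + k)" for k
    proof (induction k rule: less_induct)
      case (less k)
      show ?case
      proof (cases "k < d")
        case True
        then show ?thesis using mm(2) unfolding w_def by (auto simp: map_eq_conv)
      next
        case False
        then obtain l where k: "k = l + d" by (metis add.commute le_Suc_ex not_less)
        have "s (m + k) = (\<Sum>i = 1..d. \<alpha> i * s (m + l + d - i))"
          using rec[of "m + l"] by (simp add: k add.assoc)
        also have "\<dots> = (\<Sum>i = 1..d. \<alpha> i * s (m' + l + d - i))"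
        proof (rule sum.cong[OF refl])
          fix i assume "i \<in> {1..d}"
          then show "\<alpha> i * s (m + l + d - i) = \<alpha> i * s (m' + l + d - i)"
            using less.IH[of "k - i"] k by (simp add: add.assoc)
        qed
        also have "\<dots> = s (m' + k)" using rec[of "m' + l"] by (simp add: k add.assoc)
        finally show ?thesis .
      qed
    qed
    have "\<bar>s n\<bar> \<le> (\<Sum>i<m'. \<bar>s i\<bar>)" for n
    proof (induction n rule: less_induct)
      case (less n)
      show ?case
      proof (cases "n < m'")
        case True
        then show ?thesis by (intro member_le_sum) auto
      next
        case False
        then have "s n = s (m + (n - m'))" using per[of "n - m'"] by simp
        then show ?thesis using less[of "m + (n - m')"] False mm(1) by simp
      qed
    qed
    then have "Bseq s" by (intro BseqI'[where K = "\<Sum>i<m'. \<bar>s i\<bar>"]) simp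
    then show False using unb by blast
  qed
  then show ?thesis using d by blast
qed

text \<open>
  All logarithms are non-negative, and every window of \<open>d\<close> consecutive ones eventually contains one
  of size \<open>d * (\<bar>R\<bar> + 1)\<close>. So the average eventually exceeds \<open>R\<close>, although single values may stay
  small.
\<close>
lemma unbounded_rational_seq_log_average:
  assumes rat: "rational_seq s" and int: "\<And>n. s n \<in> \<int>" and ge1: "\<And>n. s n \<ge> 1"
    and unb: "\<not> Bseq s"
  shows "\<forall>\<^sub>F N in sequentially. R * real N \<le> (\<Sum>n<N. ln (s n))"
proof -
  obtain d where d: "d \<ge> 1" and win: "\<And>C. \<exists>n0. \<forall>n\<ge>n0. \<exists>i<d. \<bar>s (n + i)\<bar> > C"
    using unbounded_rational_seq_windows[OF rat int unb] by blast
  define R' where "R' = \<bar>R\<bar> + 1"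
  obtain n0 where n0: "\<And>n. n \<ge> n0 \<Longrightarrow> \<exists>i<d. \<bar>s (n + i)\<bar> > exp (d * R')"
    using win[of "exp (d * R')"] by blast
  have nonneg: "ln (s n) \<ge> 0" for n using ge1 by simp
  have window: "d * R' \<le> (\<Sum>i = n..<n + d. ln (s i))" if n: "n \<ge> n0" for n
  proof -
    obtain i where i: "i < d" "\<bar>s (n + i)\<bar> > exp (d * R')" using n0[OF n] by blast
    then have "d * R' \<le> ln (s (n + i))"
      using ge1[of "n + i"] by (subst ln_ge_iff) auto
    also have "\<dots> \<le> (\<Sum>i = n..<n + d. ln (s i))"
      using i nonneg by (intro member_le_sum) auto
    finally show ?thesis .
  qed
  have windows: "k * (d * R') \<le> (\<Sum>i<n0 + k * d. ln (s i))" for k :: nat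
  proof (induction k)
    case 0
    then show ?case using nonneg by (simp add: sum_nonneg)
  next
    case (Suc k)
    have "(\<Sum>i<n0 + Suc k * d. ln (s i))
        = (\<Sum>i<n0 + k * d. ln (s i)) + (\<Sum>i = n0 + k * d..<(n0 + k * d) + d. ln (s i))"
      using sum.atLeastLessThan_concat[of 0 "n0 + k * d" "n0 + k * d + d" "\<lambda>i. ln (s i)"]
      by (simp add: lessThan_atLeast0 algebra_simps)
    then show ?case using Suc window[of "n0 + k * d"] by (simp add: algebra_simps)
  qed
  have "R * real N \<le> (\<Sum>n<N. ln (s n))" if N: "N \<ge> nat \<lceil>(n0 + d) * R'\<rceil> + n0" for N
  proof -
    define k where "k = (N - n0) div d"
    have kd: "N - n0 < k * d + d" "k * d \<le> N - n0"
      using d dividend_less_div_times[of d "N - n0"] by (auto simp: k_def add.commute)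
    have "R * real N \<le> (R' - 1) * real N" unfolding R'_def by (intro mult_right_mono) auto
    also have "\<dots> \<le> R' * (real N - n0 - d)"
    proof -
      have "(n0 + d) * R' \<le> real N" using N by linarith
      then show ?thesis by (simp add: algebra_simps)
    qed
    also have "\<dots> \<le> R' * (k * d)"
    proof (rule mult_left_mono)
      have "N \<le> k * d + d + n0" using kd N by linarith
      then show "real N - n0 - d \<le> real (k * d)" by linarith
    qed (simp add: R'_def)
    also have "\<dots> = k * (d * R')" by simp
    also have "\<dots> \<le> (\<Sum>i<n0 + k * d. ln (s i))" by (rule windows)
    also have "\<dots> \<le> (\<Sum>n<N. ln (s n))" using kd N nonneg by (intro sum_mono2) auto
    finally show ?thesis .
  qed
  then show ?thesis unfolding eventually_sequentially by blast
qed


section \<open>Integrality of friezes\<close>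

lemma prod_cong_one:
  fixes F :: "'i \<Rightarrow> real"
  assumes "x \<in> \<int>" "\<And>i. i \<in> A \<Longrightarrow> \<exists>k\<in>\<int>. F i = 1 + x * k"
  shows "\<exists>k\<in>\<int>. (\<Prod>i\<in>A. F i) = 1 + x * k"
  using assms(2)
proof (induction A rule: infinite_finite_induct)
  case (insert i A)
  obtain k l where "k \<in> \<int>" "l \<in> \<int>" "F i = 1 + x * k" "(\<Prod>i\<in>A. F i) = 1 + x * l"
    using insert by (metis insertI1 insertI2)
  then have "(\<Prod>i\<in>insert i A. F i) = 1 + x * (k + l + x * k * l)" "k + l + x * k * l \<in> \<int>"
    using insert assms(1) by (auto simp: algebra_simps)
  then show ?case by blast
qed (auto intro: bexI[of _ 0])

text \<open>
  The exchange relation of the frieze reads \<open>a v (Suc n) * a v n = 1 + exchange_monomial a v n\<close>.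
\<close>
definition (in pre_digraph) exchange_monomial :: "('a \<Rightarrow> nat \<Rightarrow> real) \<Rightarrow> 'a \<Rightarrow> nat \<Rightarrow> real" where
  "exchange_monomial a v n =
     (\<Prod>e\<in>in_arcs G v. a (tail G e) (Suc n)) * (\<Prod>e\<in>out_arcs G v. a (head G e) n)"

context acyclic_quiver
begin

lemma frieze_exchange:
  assumes "is_frieze Q a" "v \<in> verts Q"
  shows "a v (Suc n) * a v n = 1 + exchange_monomial a v n"
  using frieze_step[OF assms] frieze_pos[OF assms, of n]
  by (simp add: exchange_monomial_def)

lemma frieze_head_cong_one:
  assumes fr: "is_frieze Q a" and e: "e \<in> arcs Q"
    and ints_in: "\<And>e'. e' \<in> in_arcs Q (head Q e) \<Longrightarrow> a (tail Q e') (Suc n) \<in> \<int>"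
    and ints_out: "\<And>e'. e' \<in> out_arcs Q (head Q e) \<Longrightarrow> a (head Q e') n \<in> \<int>"
  shows "\<exists>k\<in>\<int>. a (head Q e) (Suc n) * a (head Q e) n = 1 + a (tail Q e) (Suc n) * k"
proof
  let ?k = "(\<Prod>e'\<in>in_arcs Q (head Q e) - {e}. a (tail Q e') (Suc n))
    * (\<Prod>e'\<in>out_arcs Q (head Q e). a (head Q e') n)"
  have "e \<in> in_arcs Q (head Q e)" using e by simp
  then have "exchange_monomial a (head Q e) n = a (tail Q e) (Suc n) * ?k"
    unfolding exchange_monomial_def by (subst prod.remove[of _ e]) (auto simp: mult.assoc)
  then show "a (head Q e) (Suc n) * a (head Q e) n = 1 + a (tail Q e) (Suc n) * ?k"
    using frieze_exchange[OF fr head_in_verts[OF e]] by simp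
  show "?k \<in> \<int>" using ints_in ints_out by (intro Ints_mult Ints_prod) blast+
qed

lemma frieze_tail_cong_one:
  assumes fr: "is_frieze Q a" and e: "e \<in> arcs Q"
    and ints_in: "\<And>e'. e' \<in> in_arcs Q (tail Q e) \<Longrightarrow> a (tail Q e') (Suc n) \<in> \<int>"
    and ints_out: "\<And>e'. e' \<in> out_arcs Q (tail Q e) \<Longrightarrow> a (head Q e') n \<in> \<int>"
  shows "\<exists>k\<in>\<int>. a (tail Q e) (Suc n) * a (tail Q e) n = 1 + a (head Q e) n * k"
proof
  let ?k = "(\<Prod>e'\<in>in_arcs Q (tail Q e). a (tail Q e') (Suc n))
    * (\<Prod>e'\<in>out_arcs Q (tail Q e) - {e}. a (head Q e') n)"
  have "e \<in> out_arcs Q (tail Q e)" using e by simp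
  then have "exchange_monomial a (tail Q e) n = a (head Q e) n * ?k"
    unfolding exchange_monomial_def by (subst prod.remove[of "out_arcs _ _" e]) (auto simp: mult_ac)
  then show "a (tail Q e) (Suc n) * a (tail Q e) n = 1 + a (head Q e) n * ?k"
    using frieze_exchange[OF fr tail_in_verts[OF e]] by simp
  show "?k \<in> \<int>" using ints_in ints_out by (intro Ints_mult Ints_prod) blast+
qed

text \<open>
  Modulo \<open>x = a v (Suc n)\<close> every neighbour \<open>w\<close> of \<open>v\<close> has two consecutive values with product
  \<open>1\<close>, because \<open>x\<close> divides their exchange monomial. Multiplying over all arcs at \<open>v\<close> shows that the
  exchange monomials \<open>M'\<close> and \<open>M\<close> before and after \<open>x\<close> are inverse to each other. As \<open>M'\<close> is \<open>-1\<close>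
  modulo \<open>x\<close>, so is \<open>M\<close>, and hence \<open>x\<close> divides \<open>1 + M\<close>.
\<close>
lemma frieze_Ints_step:
  assumes fr: "is_frieze Q a" and v: "v \<in> verts Q"
    and earlier: "\<And>w k. w \<in> verts Q \<Longrightarrow> k \<le> Suc n \<Longrightarrow> a w k \<in> \<int>"
    and before: "\<And>w. (w, v) \<in> (arcs_ends Q)\<^sup>+ \<Longrightarrow> a w (Suc (Suc n)) \<in> \<int>"
  shows "a v (Suc (Suc n)) \<in> \<int>"
proof -
  define x M M' where "x = a v (Suc n)" and "M = exchange_monomial a v (Suc n)"
    and "M' = exchange_monomial a v n"
  have xI: "x \<in> \<int>" and x0: "x > 0"
    using earlier[OF v] frieze_pos[OF fr v] by (auto simp: x_def)
  have M: "a v (Suc (Suc n)) * x = 1 + M" and M': "x * a v n = 1 + M'"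
    unfolding x_def M_def M'_def by (rule frieze_exchange[OF fr v])+
  have arc: "(tail Q e, head Q e) \<in> (arcs_ends Q)\<^sup>+" if "e \<in> arcs Q" for e
    using that by (auto simp: arcs_ends_conv)
  have "\<exists>k\<in>\<int>. a (tail Q e) (Suc (Suc n)) * a (tail Q e) (Suc n) = 1 + x * k"
    if e: "e \<in> in_arcs Q v" for e
  proof -
    have "a (tail Q e') (Suc (Suc n)) \<in> \<int>" if e': "e' \<in> in_arcs Q (tail Q e)" for e'
      using arc[of e] arc[of e'] e e' by (intro before) (auto intro: trancl_trans)
    then show ?thesis
      using frieze_tail_cong_one[OF fr, of e "Suc n"] e earlier by (auto simp: x_def)
  qed
  from prod_cong_one[OF xI this] obtain k1 where k1: "k1 \<in> \<int>"
    "(\<Prod>e\<in>in_arcs Q v. a (tail Q e) (Suc (Suc n)) * a (tail Q e) (Suc n)) = 1 + x * k1" ..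
  have "\<exists>k\<in>\<int>. a (head Q e) (Suc n) * a (head Q e) n = 1 + x * k"
    if e: "e \<in> out_arcs Q v" for e
    using frieze_head_cong_one[OF fr, of e n] e earlier by (auto simp: x_def)
  from prod_cong_one[OF xI this] obtain k2 where k2: "k2 \<in> \<int>"
    "(\<Prod>e\<in>out_arcs Q v. a (head Q e) (Suc n) * a (head Q e) n) = 1 + x * k2" ..
  define k where "k = k1 + k2 + x * k1 * k2"
  have "M * M' = (1 + x * k1) * (1 + x * k2)"
    unfolding M_def M'_def exchange_monomial_def k1(2)[symmetric] k2(2)[symmetric]
    by (simp add: prod.distrib)
  then have MM': "M * M' = 1 + x * k" by (simp add: k_def algebra_simps)
  have "a w (Suc (Suc n)) \<in> \<int>" if "e \<in> in_arcs Q v" "w = tail Q e" for e w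
    using arc[of e] that by (intro before) auto
  then have "M \<in> \<int>" unfolding M_def exchange_monomial_def
    using earlier by (intro Ints_mult Ints_prod) auto
  have "M * (x * a v n - 1) = 1 + x * k" unfolding M' using MM' by simp
  moreover have "x * (M * a v n - k) = M * (x * a v n - 1) + M - x * k"
    by (simp add: algebra_simps)
  ultimately have "x * (M * a v n - k) = x * a v (Suc (Suc n))" using M by (simp add: mult.commute)
  then have "a v (Suc (Suc n)) = M * a v n - k" using x0 by simp
  moreover have "k \<in> \<int>" using xI k1 k2 by (simp add: k_def)
  moreover have "a v n \<in> \<int>" using earlier[OF v] by simp
  ultimately show ?thesis using \<open>M \<in> \<int>\<close> by simp
qed

lemma frieze_Ints:
  assumes fr: "is_frieze Q a" and v: "v \<in> verts Q"
  shows "a v n \<in> \<int>"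
proof -
  let ?r = "less_than <*lex*> arcs_ends Q"
  have lift: "((n, w), (n, v)) \<in> ?r\<^sup>+" if "(w, v) \<in> (arcs_ends Q)\<^sup>+" for w v n
    using that
  proof (induction rule: trancl_induct)
    case (base y)
    then have "((n, w), (n, y)) \<in> ?r" by simp
    then show ?case by (rule r_into_trancl)
  next
    case (step y z)
    then have "((n, y), (n, z)) \<in> ?r" by simp
    with step.IH show ?case by (rule trancl_into_trancl)
  qed
  have "snd x \<in> verts Q \<longrightarrow> a (snd x) (fst x) \<in> \<int>" for x
  proof (induction x rule: wf_induct_rule[OF wf_trancl[OF wf_frieze_order]])
    case (1 x)
    obtain n v where x: "x = (n, v)" by fastforce
    have earlier: "a w m \<in> \<int>" if "w \<in> verts Q" "m < n" for w m
    proof -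
      have "((m, w), x) \<in> ?r" using that x by simp
      from 1[OF r_into_trancl[OF this]] show ?thesis using that by simp
    qed
    have before: "a w n \<in> \<int>" if w: "(w, v) \<in> (arcs_ends Q)\<^sup>+" for w
    proof -
      have "w \<in> verts Q" using tranclD[OF w] by (auto simp: arcs_ends_conv)
      then show ?thesis using 1[OF lift[OF w, of n, folded x]] by simp
    qed
    have "a v n \<in> \<int>" if v: "v \<in> verts Q"
    proof (cases n)
      case 0
      then show ?thesis using frieze_0[OF fr v] by simp
    next
      case n: (Suc m)
      show ?thesis
      proof (cases m)
        case 0
        have "a v 1 = 1 + exchange_monomial a v 0"
          using frieze_exchange[OF fr v, of 0] frieze_0[OF fr v] by simp
        moreover have "a (tail Q e) 1 \<in> \<int>" if "e \<in> in_arcs Q v" for e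
          using before[of "tail Q e"] that n 0 by (auto simp: arcs_ends_conv)
        then have "exchange_monomial a v 0 \<in> \<int>"
          unfolding exchange_monomial_def using frieze_0[OF fr]
          by (intro Ints_mult Ints_prod) auto
        ultimately show ?thesis using n 0 by simp
      next
        case m: (Suc l)
        show ?thesis unfolding n m
          by (rule frieze_Ints_step[OF fr v]) (use earlier before n m in auto)
      qed
    qed
    then show ?case using x by simp
  qed
  from this[of "(n, v)"] show ?thesis using v by simp
qed

lemma frieze_ge_1:
  assumes "is_frieze Q a" "v \<in> verts Q"
  shows "a v n \<ge> 1"
  using frieze_Ints[OF assms, of n] frieze_pos[OF assms, of n] by (auto elim!: Ints_cases)

lemma frieze_prods_ge_1:
  assumes "is_frieze Q a"
  shows "(\<Prod>e\<in>in_arcs Q v. a (tail Q e) n) \<ge> 1" "(\<Prod>e\<in>out_arcs Q v. a (head Q e) n) \<ge> 1"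
  using frieze_ge_1[OF assms] by (auto intro!: prod_ge_1)

lemma exchange_monomial_ge_1:
  assumes "is_frieze Q a"
  shows "exchange_monomial a v n \<ge> 1"
proof -
  have "1 * 1 \<le> exchange_monomial a v n"
    unfolding exchange_monomial_def
    by (intro mult_mono) (use frieze_prods_ge_1[OF assms, of _ v] in \<open>auto intro: order_trans[OF zero_le_one]\<close>)
  then show ?thesis by simp
qed

lemma frieze_neighbour_le:
  assumes fr: "is_frieze Q a" and e: "e \<in> arcs Q"
  shows "a (tail Q e) (Suc n) \<le> a (head Q e) (Suc n) * a (head Q e) n"
    and "a (head Q e) n \<le> a (tail Q e) (Suc n) * a (tail Q e) n"
proof -
  let ?v = "head Q e" and ?w = "tail Q e"
  have member: "f i \<le> prod f A" if "i \<in> A" "finite A" "\<And>j. j \<in> A \<Longrightarrow> 1 \<le> f j"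
    for f :: "'e \<Rightarrow> real" and A i
  proof -
    have "1 \<le> prod f (A - {i})" using that by (intro prod_ge_1) auto
    moreover have "0 \<le> f i" using that(1,3) by force
    ultimately have "f i * 1 \<le> f i * prod f (A - {i})" by (intro mult_left_mono)
    then show ?thesis using that by (simp add: prod.remove)
  qed
  have "a ?w (Suc n) \<le> (\<Prod>e\<in>in_arcs Q ?v. a (tail Q e) (Suc n))"
    using e frieze_ge_1[OF fr] by (intro member[of e]) auto
  also have "\<dots> \<le> \<dots> * (\<Prod>e\<in>out_arcs Q ?v. a (head Q e) n)"
    using frieze_prods_ge_1(1)[OF fr, of "Suc n" ?v] frieze_prods_ge_1(2)[OF fr, of n ?v]
      mult_left_mono[of 1 "\<Prod>e\<in>out_arcs Q ?v. a (head Q e) n"] by force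
  finally show "a ?w (Suc n) \<le> a ?v (Suc n) * a ?v n"
    using frieze_exchange[OF fr head_in_verts[OF e]] by (simp add: exchange_monomial_def)
  have "a ?v n \<le> (\<Prod>e\<in>out_arcs Q ?w. a (head Q e) n)"
    using e frieze_ge_1[OF fr] by (intro member[of e "out_arcs Q ?w"]) auto
  also have "\<dots> \<le> (\<Prod>e\<in>in_arcs Q ?w. a (tail Q e) (Suc n)) * \<dots>"
    using frieze_prods_ge_1(1)[OF fr, of "Suc n" ?w] frieze_prods_ge_1(2)[OF fr, of n ?w]
      mult_right_mono[of 1 "\<Prod>e\<in>in_arcs Q ?w. a (tail Q e) (Suc n)"] by force
  finally show "a ?v n \<le> a ?w (Suc n) * a ?w n"
    using frieze_exchange[OF fr tail_in_verts[OF e]] by (simp add: exchange_monomial_def)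
qed

end

section \<open>The logarithm of a frieze and the Cartan operator\<close>

text \<open>
  This is \<open>2 - A\<close> with the adjacency matrix \<open>A\<close> of the underlying graph, that is, the symmetric
  generalized Cartan matrix of the quiver.
\<close>
definition (in pre_digraph) cartan :: "('a \<Rightarrow> real) \<Rightarrow> 'a \<Rightarrow> real" where
  "cartan f v = 2 * f v - (\<Sum>e\<in>in_arcs G v. f (tail G e)) - (\<Sum>e\<in>out_arcs G v. f (head G e))"

context acyclic_quiver
begin

lemma ln_frieze_exchange:
  assumes fr: "is_frieze Q a" and v: "v \<in> verts Q"
  shows "ln (a v n) + ln (a v (Suc n)) =
    (\<Sum>e\<in>in_arcs Q v. ln (a (tail Q e) (Suc n))) + (\<Sum>e\<in>out_arcs Q v. ln (a (head Q e) n))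
    + ln (1 + 1 / exchange_monomial a v n)"
proof -
  let ?M = "exchange_monomial a v n"
  have M: "?M \<ge> 1" by (rule exchange_monomial_ge_1[OF fr])
  have pos: "a w k > 0" if "w \<in> verts Q" for w k using frieze_pos[OF fr that] .
  have "ln (a v n) + ln (a v (Suc n)) = ln (a v (Suc n) * a v n)"
    using pos[OF v, of n] pos[OF v, of "Suc n"] by (simp add: ln_mult_pos)
  also have "\<dots> = ln (?M * (1 + 1 / ?M))"
    using M by (simp add: frieze_exchange[OF fr v] distrib_left add.commute)
  also have "\<dots> = ln ?M + ln (1 + 1 / ?M)"
    using M by (intro ln_mult_pos) (auto simp: add_pos_pos)
  also have "ln ?M = ln (\<Prod>e\<in>in_arcs Q v. a (tail Q e) (Suc n))
      + ln (\<Prod>e\<in>out_arcs Q v. a (head Q e) n)"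
    unfolding exchange_monomial_def by (intro ln_mult_pos prod_pos) (auto intro: pos)
  also have "ln (\<Prod>e\<in>in_arcs Q v. a (tail Q e) (Suc n)) = (\<Sum>e\<in>in_arcs Q v. ln (a (tail Q e) (Suc n)))"
    by (intro ln_prod) (auto intro: pos simp: less_imp_neq[OF pos, symmetric])
  also have "ln (\<Prod>e\<in>out_arcs Q v. a (head Q e) n) = (\<Sum>e\<in>out_arcs Q v. ln (a (head Q e) n))"
    by (intro ln_prod) (auto intro: pos simp: less_imp_neq[OF pos, symmetric])
  finally show ?thesis by simp
qed

text \<open>
  Depending on the direction of the arc, a neighbour enters the exchange relation with index \<open>n\<close> or
  \<open>Suc n\<close>. After summation over \<open>n < N\<close> the two differ only by a boundary term. Therefore the partial sums of the logarithms
  satisfy the linear equations given by the Cartan operator, up to the boundary and an error of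
  bounded size per step.
\<close>
lemma cartan_sum_ln_frieze:
  assumes fr: "is_frieze Q a" and v: "v \<in> verts Q"
  shows "cartan (\<lambda>w. \<Sum>n<N. ln (a w n)) v = (\<Sum>n<N. ln (1 + 1 / exchange_monomial a v n))
    - ln (a v N) + (\<Sum>e\<in>in_arcs Q v. ln (a (tail Q e) N))"
proof (induction N)
  case 0
  have "(\<Sum>e\<in>in_arcs Q v. ln (a (tail Q e) 0)) = 0"
    using frieze_0[OF fr] by (intro sum.neutral) auto
  then show ?case using frieze_0[OF fr v] by (simp add: cartan_def)
next
  case (Suc N)
  then show ?case using ln_frieze_exchange[OF fr v, of N]
    by (simp add: cartan_def sum.distrib)
qed

text \<open>
  Bounded exchange monomials keep the error \<open>ln (1 + 1 / M)\<close> of each step above a fixed \<open>\<delta> > 0\<close>, so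
  for large \<open>N\<close> the accumulated errors outweigh the boundary terms.
\<close>
lemma bounded_frieze_imp_strictly_subadditive:
  assumes fr: "is_frieze Q a" and bdd: "\<forall>v\<in>verts Q. Bseq (a v)"
  shows "\<exists>f. \<forall>v\<in>verts Q. f v \<ge> 0 \<and> cartan f v > 0"
proof -
  have "\<forall>v\<in>verts Q. \<exists>K. \<forall>n. a v n \<le> K"
    using bdd unfolding Bseq_def by (metis abs_le_D1 real_norm_def)
  then obtain K where K: "\<And>v n. v \<in> verts Q \<Longrightarrow> a v n \<le> K v" by metis
  define C where "C = 1 + (\<Sum>v\<in>verts Q. \<bar>K v\<bar>)"
  have C1: "C \<ge> 1" unfolding C_def by (simp add: sum_nonneg)
  have C: "a v n \<le> C" if "v \<in> verts Q" for v n
  proof -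
    have "\<bar>K v\<bar> \<le> (\<Sum>v\<in>verts Q. \<bar>K v\<bar>)" using that by (intro member_le_sum) auto
    then show ?thesis using K[OF that, of n] by (simp add: C_def)
  qed
  define \<delta> where "\<delta> = ln (1 + 1 / C\<^sup>2)"
  have "\<delta> > 0" using C1 unfolding \<delta>_def by (intro ln_gt_zero) simp
  have error: "\<delta> \<le> ln (1 + 1 / exchange_monomial a v n)" if v: "v \<in> verts Q" for v n
  proof -
    have "exchange_monomial a v n \<le> a v (Suc n) * a v n" using frieze_exchange[OF fr v] by simp
    also have "\<dots> \<le> C * C"
      using C[OF v] frieze_pos[OF fr v] C1 by (intro mult_mono) (auto intro: less_imp_le)
    finally show ?thesis using exchange_monomial_ge_1[OF fr, of v n] C1
      unfolding \<delta>_def by (subst ln_le_cancel_iff) (auto simp: power2_eq_square frac_le add_pos_pos)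
  qed
  obtain N :: nat where N: "ln C < N * \<delta>"
    using \<open>\<delta> > 0\<close> reals_Archimedean3 by blast
  have "cartan (\<lambda>w. \<Sum>n<N. ln (a w n)) v > 0" if v: "v \<in> verts Q" for v
  proof -
    have "N * \<delta> \<le> (\<Sum>n<N. ln (1 + 1 / exchange_monomial a v n))"
      using sum_mono[of "{..<N}" "\<lambda>_. \<delta>", OF error[OF v]] by simp
    moreover have "ln (a v N) \<le> ln C"
      using C[OF v] frieze_pos[OF fr v] C1 by simp
    moreover have "0 \<le> (\<Sum>e\<in>in_arcs Q v. ln (a (tail Q e) N))"
      using frieze_ge_1[OF fr] by (intro sum_nonneg ln_ge_zero) auto
    ultimately show ?thesis using N unfolding cartan_sum_ln_frieze[OF fr v] by linarith
  qed
  moreover have "0 \<le> (\<Sum>n<N. ln (a w n))" if "w \<in> verts Q" for w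
    using frieze_ge_1[OF fr that] by (intro sum_nonneg ln_ge_zero) auto
  ultimately show ?thesis by (intro exI[of _ "\<lambda>w. \<Sum>n<N. ln (a w n)"]) blast
qed

text \<open>
  Rationality enters twice: values grow at most exponentially, so the boundary terms above are
  \<open>O(N)\<close>, whereas the sums of logarithms grow faster than any multiple of \<open>N\<close>. Rescaling by a
  multiple of \<open>N\<close> gives functions that are as large as desired but remain almost additive.
\<close>
lemma unbounded_rational_frieze_imp_almost_additive:
  assumes fr: "is_frieze Q a" and rat: "rational_frieze Q a" and unb: "\<forall>v\<in>verts Q. \<not> Bseq (a v)"
  shows "\<exists>f. \<forall>v\<in>verts Q. f v \<ge> R \<and> \<bar>cartan f v\<bar> \<le> 1"
proof -
  have "\<exists>b::real\<ge>0. \<forall>n. ln (a v n) \<le> b * (real n + 1)" if v: "v \<in> verts Q" for v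
  proof -
    obtain C B where "C \<ge> 1" "B \<ge> 1" and le: "\<And>n. \<bar>a v n\<bar> \<le> C * B ^ n"
      using rational_seq_exponential_bound[of "a v"] rat v unfolding rational_frieze_def by blast
    have "ln (a v n) \<le> (ln C + ln B) * (real n + 1)" for n
    proof -
      have "ln (a v n) \<le> ln (C * B ^ n)"
        using le[of n] frieze_pos[OF fr v, of n] by (intro ln_mono) auto
      also have "\<dots> = ln C + n * ln B" using \<open>C \<ge> 1\<close> \<open>B \<ge> 1\<close> by (simp add: ln_mult ln_realpow)
      also have "\<dots> \<le> (ln C + ln B) * (real n + 1)"
        using \<open>C \<ge> 1\<close> \<open>B \<ge> 1\<close> by (simp add: algebra_simps)
      finally show ?thesis .
    qed
    then show ?thesis using \<open>C \<ge> 1\<close> \<open>B \<ge> 1\<close> by (intro exI[of _ "ln C + ln B"]) auto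
  qed
  then obtain b where b: "\<And>v. v \<in> verts Q \<Longrightarrow> b v \<ge> 0"
      "\<And>v n. v \<in> verts Q \<Longrightarrow> ln (a v n) \<le> b v * (real n + 1)"
    by metis
  define B where "B = (\<Sum>v\<in>verts Q. b v)"
  have B0: "B \<ge> 0" unfolding B_def by (intro sum_nonneg b)
  have B: "ln (a v n) \<le> B * (real n + 1)" if "v \<in> verts Q" for v n
  proof -
    have "b v \<le> B" unfolding B_def using that b(1) by (intro member_le_sum) auto
    then show ?thesis using b(2)[OF that, of n] mult_right_mono[OF \<open>b v \<le> B\<close>, of "real n + 1"]
      by linarith
  qed
  have ln0: "0 \<le> ln (a v n)" if "v \<in> verts Q" for v n using frieze_ge_1[OF fr that] by simp
  \<comment> \<open>The three summands of \<open>K\<close> bound the error per step and the two kinds of boundary terms.\<close>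
  define K where "K = 1 + 2 * B + 2 * B * card (arcs Q)"
  have K: "K \<ge> 1" using B0 by (simp add: K_def)
  have "\<forall>v\<in>verts Q. \<forall>\<^sub>F N in sequentially. R * K * real N \<le> (\<Sum>n<N. ln (a v n))"
    using rat unb frieze_Ints[OF fr] frieze_ge_1[OF fr]
    by (auto intro!: unbounded_rational_seq_log_average simp: rational_frieze_def)
  then have "\<forall>\<^sub>F N in sequentially. \<forall>v\<in>verts Q. R * K * real N \<le> (\<Sum>n<N. ln (a v n))"
    by (intro eventually_ball_finite) auto
  with eventually_ge_at_top[of 1]
  have "\<forall>\<^sub>F N in sequentially. N \<ge> 1 \<and> (\<forall>v\<in>verts Q. R * K * real N \<le> (\<Sum>n<N. ln (a v n)))"
    by (rule eventually_conj)
  then obtain N where N: "N \<ge> 1" "\<And>v. v \<in> verts Q \<Longrightarrow> R * K * real N \<le> (\<Sum>n<N. ln (a v n))"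
    using eventually_happens'[OF sequentially_bot] by blast
  have KN: "K * real N > 0" using K N(1) by simp
  have BN: "B * (real N + 1) \<le> 2 * B * N"
    using mult_left_mono[OF _ B0, of "real N + 1" "2 * real N"] N(1) by (simp add: algebra_simps)
  define f where "f v = (\<Sum>n<N. ln (a v n)) / (K * N)" for v
  have "f v \<ge> R" if "v \<in> verts Q" for v
    using N(2)[OF that] KN by (simp add: f_def field_simps)
  moreover have "\<bar>cartan f v\<bar> \<le> 1" if v: "v \<in> verts Q" for v
  proof -
    let ?E = "\<Sum>n<N. ln (1 + 1 / exchange_monomial a v n)"
    let ?T = "\<Sum>e\<in>in_arcs Q v. ln (a (tail Q e) N)"
    have "cartan f v = cartan (\<lambda>w. \<Sum>n<N. ln (a w n)) v / (K * N)"
      unfolding cartan_def f_def by (simp add: sum_divide_distrib[symmetric] diff_divide_distrib)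
    moreover have "\<bar>?E - ln (a v N) + ?T\<bar> \<le> K * N"
    proof -
      have m: "exchange_monomial a v n \<ge> 1" for n by (rule exchange_monomial_ge_1[OF fr])
      have "ln (1 + 1 / exchange_monomial a v n) \<le> 1" for n
      proof -
        have "ln (1 + 1 / exchange_monomial a v n) \<le> 1 / exchange_monomial a v n"
          using m[of n] by (intro ln_add_one_self_le_self) simp
        also have "\<dots> \<le> 1" using m[of n] by simp
        finally show ?thesis .
      qed
      then have "?E \<le> N" using sum_bounded_above[of "{..<N}" _ "1::real"] by simp
      moreover have "0 \<le> ln (1 + 1 / exchange_monomial a v n)" for n
        using m[of n] by (intro ln_ge_zero) simp
      then have "0 \<le> ?E" by (intro sum_nonneg) auto
      moreover have "0 \<le> ?T" using ln0 by (intro sum_nonneg) auto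
      moreover have "?T \<le> 2 * B * card (arcs Q) * N"
      proof -
        have "?T \<le> (\<Sum>e\<in>in_arcs Q v. 2 * B * N)"
          by (intro sum_mono order_trans[OF B BN]) auto
        also have "\<dots> \<le> card (arcs Q) * (2 * B * N)"
          using B0 by (auto simp: in_arcs_def intro!: mult_right_mono card_mono)
        finally show ?thesis by (simp add: mult_ac)
      qed
      moreover have "0 \<le> ln (a v N)" "ln (a v N) \<le> 2 * B * N"
        using ln0[OF v] order_trans[OF B[OF v] BN] by auto
      moreover have "K * N = N + 2 * B * N + 2 * B * card (arcs Q) * N"
        by (simp add: K_def algebra_simps)
      moreover have "0 \<le> 2 * B * N" "0 \<le> 2 * B * card (arcs Q) * N" using B0 by simp_all
      ultimately show ?thesis by linarith
    qed
    ultimately show ?thesis using KN cartan_sum_ln_frieze[OF fr v, of N] by (simp add: abs_divide)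
  qed
  ultimately show ?thesis by blast
qed

end

section \<open>Connected multigraphs and embedded diagrams\<close>

locale connected_multigraph = fin_digraph Q for Q :: "('v, 'e) pre_digraph" (structure) +
  assumes connected: "Digraph_Component.connected Q"
    and no_loop: "e \<in> arcs Q \<Longrightarrow> tail Q e \<noteq> head Q e"
begin

text \<open>
  The operator \<^const>\<open>pre_digraph.cartan\<close> sums over all neighbours alike, so for the classification
  an arc is just an edge, given by the set of its ends.
\<close>
definition ends :: "'e \<Rightarrow> 'v set" where
  "ends e = {tail Q e, head Q e}"

definition adjacent :: "'v \<Rightarrow> 'v \<Rightarrow> bool" where
  "adjacent u v \<longleftrightarrow> (\<exists>e\<in>arcs Q. ends e = {u, v})"

lemma adjacent_sym: "adjacent u v \<longleftrightarrow> adjacent v u"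
  by (simp add: adjacent_def insert_commute)

lemma adjacent_in_verts: "adjacent u v \<Longrightarrow> u \<in> verts Q \<and> v \<in> verts Q"
  by (auto simp: adjacent_def ends_def doubleton_eq_iff)

lemma adjacent_neq: "adjacent u v \<Longrightarrow> u \<noteq> v"
  using no_loop by (fastforce simp: adjacent_def ends_def doubleton_eq_iff)

lemma adjacent_arc: "e \<in> arcs Q \<Longrightarrow> adjacent (tail Q e) (head Q e)"
  by (auto simp: adjacent_def ends_def)

lemma verts_nonempty: "verts Q \<noteq> {}"
  using connected unfolding connected_def strongly_connected_def by simp

lemma adjacent_closed_imp_all:
  assumes "U \<subseteq> verts Q" "U \<noteq> {}" and closed: "\<And>u v. u \<in> U \<Longrightarrow> adjacent u v \<Longrightarrow> v \<in> U"
  shows "U = verts Q"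
proof -
  interpret S: pair_wf_digraph "mk_symmetric Q" ..
  obtain u where u: "u \<in> U" using assms by blast
  have "v \<in> U" if "v \<in> verts Q" for v
  proof -
    have "u \<rightarrow>\<^sup>*\<^bsub>with_proj (mk_symmetric Q)\<^esub> v"
      using connected that u assms(1) unfolding connected_def strongly_connected_def by auto
    then show ?thesis
    proof (induction rule: S.reachable_induct)
      case base
      show ?case by (rule u)
    next
      case (step x y)
      then have "adjacent x y"
        by (auto simp: parcs_mk_symmetric adjacent_def ends_def)
      then show ?case using step closed by blast
    qed
  qed
  then show ?thesis using assms(1) by blast
qed

text \<open>The Cartan operator is self-adjoint; this is the associated symmetric bilinear form.\<close>
lemma sum_mult_cartan:
  "(\<Sum>v\<in>verts Q. g v * cartan f v) = (\<Sum>v\<in>verts Q. 2 * g v * f v)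
    - (\<Sum>e\<in>arcs Q. g (head Q e) * f (tail Q e) + g (tail Q e) * f (head Q e))"
proof -
  have "(\<Sum>v\<in>verts Q. g v * (\<Sum>e\<in>in_arcs Q v. f (tail Q e)))
      = (\<Sum>v\<in>verts Q. \<Sum>e | e \<in> arcs Q \<and> head Q e = v. g (head Q e) * f (tail Q e))"
    unfolding sum_distrib_left by (intro sum.cong) (auto simp: in_arcs_def)
  also have "\<dots> = (\<Sum>e\<in>arcs Q. g (head Q e) * f (tail Q e))"
    by (rule sum.group) auto
  finally have 1: "(\<Sum>v\<in>verts Q. g v * (\<Sum>e\<in>in_arcs Q v. f (tail Q e)))
      = (\<Sum>e\<in>arcs Q. g (head Q e) * f (tail Q e))" .
  have "(\<Sum>v\<in>verts Q. g v * (\<Sum>e\<in>out_arcs Q v. f (head Q e)))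
      = (\<Sum>v\<in>verts Q. \<Sum>e | e \<in> arcs Q \<and> tail Q e = v. g (tail Q e) * f (head Q e))"
    unfolding sum_distrib_left by (intro sum.cong) (auto simp: out_arcs_def)
  also have "\<dots> = (\<Sum>e\<in>arcs Q. g (tail Q e) * f (head Q e))"
    by (rule sum.group) auto
  finally show ?thesis
    using 1 by (simp add: cartan_def right_diff_distrib sum_subtractf sum.distrib mult_ac)
qed

text \<open>
  The edges of the diagram carry an index, so that both the diagram and \<open>Q\<close> may have multiple edges.
  The image is a subgraph of \<open>Q\<close>, not necessarily an induced one.
\<close>
definition embedding ::
    "'j set \<Rightarrow> 'i set \<Rightarrow> ('i \<Rightarrow> 'j) \<Rightarrow> ('i \<Rightarrow> 'j) \<Rightarrow> ('j \<Rightarrow> 'v) \<Rightarrow> ('i \<Rightarrow> 'e) \<Rightarrow> bool" where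
  "embedding J I x y h d \<longleftrightarrow> finite J \<and> finite I \<and> inj_on h J \<and> h ` J \<subseteq> verts Q
     \<and> inj_on d I \<and> d ` I \<subseteq> arcs Q
     \<and> (\<forall>i\<in>I. x i \<in> J \<and> y i \<in> J \<and> ends (d i) = {h (x i), h (y i)})"

lemma embedding_of_adjacent:
  assumes "finite J" "finite I" "inj_on h J" "h ` J \<subseteq> verts Q"
    and edges: "\<And>i. i \<in> I \<Longrightarrow> x i \<in> J \<and> y i \<in> J \<and> adjacent (h (x i)) (h (y i))"
    and inj: "inj_on (\<lambda>i. {x i, y i}) I"
  shows "\<exists>d. embedding J I x y h d"
proof -
  have "\<forall>i\<in>I. \<exists>e. e \<in> arcs Q \<and> ends e = {h (x i), h (y i)}"
    using edges unfolding adjacent_def by blast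
  then obtain d where d: "\<And>i. i \<in> I \<Longrightarrow> d i \<in> arcs Q \<and> ends (d i) = h ` {x i, y i}"
    unfolding image_insert image_empty by metis
  have "inj_on d I"
  proof (rule inj_onI)
    fix i j assume ij: "i \<in> I" "j \<in> I" "d i = d j"
    then have "h ` {x i, y i} = h ` {x j, y j}" using d by metis
    then have "{x i, y i} = {x j, y j}"
      using edges ij by (subst (asm) inj_on_image_eq_iff[OF assms(3)]) auto
    then show "i = j" using inj ij by (auto dest: inj_onD)
  qed
  then show ?thesis using assms d unfolding embedding_def by auto
qed

lemma surjective_embedding_imp_iso:
  assumes emb: "embedding J I x y h d" and "h ` J = verts Q" "d ` I = arcs Q"
  shows "underlying_graph Q \<cong>\<^sub>M (J, {# {x i, y i}. i \<in># mset_set I #})"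
proof -
  let ?f = "the_inv_into J h"
  note emb = emb[unfolded embedding_def]
  have bij: "bij_betw ?f (verts Q) J"
    using emb assms by (intro bij_betw_the_inv_into) (auto simp: bij_betw_def)
  have "{# ?f ` E. E \<in># {# ends e. e \<in># mset_set (arcs Q) #} #}
      = {# ?f ` ends e. e \<in># mset_set (d ` I) #}"
    using assms by (simp add: multiset.map_comp comp_def)
  also have "mset_set (d ` I) = {# d i. i \<in># mset_set I #}"
    using emb by (simp add: image_mset_mset_set)
  also have "{# ?f ` ends e. e \<in># {# d i. i \<in># mset_set I #} #}
      = {# ?f ` ends (d i). i \<in># mset_set I #}"
    by (simp add: multiset.map_comp comp_def)
  also have "\<dots> = {# {x i, y i}. i \<in># mset_set I #}"
    using emb by (intro image_mset_cong) (auto simp: the_inv_into_f_f)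
  finally show ?thesis using bij
    unfolding multigraph_iso_def underlying_graph_def ends_def by auto
qed

lemma embedding_covers_arcs:
  assumes "embedding J I x y h d" "inj_on ends (arcs Q)"
    and "ends ` arcs Q \<subseteq> (\<lambda>i. {h (x i), h (y i)}) ` I"
  shows "d ` I = arcs Q"
proof
  show "d ` I \<subseteq> arcs Q" using assms(1) by (simp add: embedding_def)
  show "arcs Q \<subseteq> d ` I"
  proof
    fix e assume e: "e \<in> arcs Q"
    then obtain i where i: "i \<in> I" "ends e = {h (x i), h (y i)}" using assms(3) by blast
    then have "ends e = ends (d i)" "d i \<in> arcs Q" using assms(1) by (auto simp: embedding_def)
    then have "e = d i" using assms(2) e by (auto dest: inj_onD)
    then show "e \<in> d ` I" using i by blast
  qed
qed

definition extend_zero :: "'j set \<Rightarrow> ('j \<Rightarrow> 'v) \<Rightarrow> ('j \<Rightarrow> real) \<Rightarrow> 'v \<Rightarrow> real" where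
  "extend_zero J h G v = (if v \<in> h ` J then G (the_inv_into J h v) else 0)"

text \<open>
  Testing \<open>cartan f\<close> against a function supported on an embedded diagram gives the bilinear form
  of that diagram, corrected by the arcs that do not belong to it. For non-negative functions this
  correction has a sign.
\<close>
lemma sum_extend_zero_mult_cartan:
  assumes emb: "embedding J I x y h d" and g_def: "g = extend_zero J h G"
  shows "(\<Sum>v\<in>verts Q. g v * cartan f v) =
    (\<Sum>j\<in>J. 2 * G j * f (h j)) - (\<Sum>i\<in>I. G (x i) * f (h (y i)) + G (y i) * f (h (x i)))
    - (\<Sum>e\<in>arcs Q - d ` I. g (head Q e) * f (tail Q e) + g (tail Q e) * f (head Q e))"
proof -
  note emb = emb[unfolded embedding_def]
  have g: "g (h j) = G j" if "j \<in> J" for j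
    using emb that by (auto simp: g_def extend_zero_def the_inv_into_f_f)
  let ?\<phi> = "\<lambda>e. g (head Q e) * f (tail Q e) + g (tail Q e) * f (head Q e)"
  have "(\<Sum>v\<in>verts Q. 2 * g v * f v) = (\<Sum>v\<in>h ` J. 2 * g v * f v)"
    using emb by (intro sum.mono_neutral_right) (auto simp: g_def extend_zero_def)
  also have "\<dots> = (\<Sum>j\<in>J. 2 * G j * f (h j))"
    using emb g by (subst sum.reindex) auto
  finally have 1: "(\<Sum>v\<in>verts Q. 2 * g v * f v) = (\<Sum>j\<in>J. 2 * G j * f (h j))" .
  have "?\<phi> (d i) = G (x i) * f (h (y i)) + G (y i) * f (h (x i))" if i: "i \<in> I" for i
  proof -
    have "{tail Q (d i), head Q (d i)} = {h (x i), h (y i)}" and J: "x i \<in> J" "y i \<in> J"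
      using emb i unfolding ends_def by auto
    then show ?thesis using g[OF J(1)] g[OF J(2)] by (auto simp: doubleton_eq_iff)
  qed
  then have 2: "(\<Sum>e\<in>d ` I. ?\<phi> e) = (\<Sum>i\<in>I. G (x i) * f (h (y i)) + G (y i) * f (h (x i)))"
    using emb by (subst sum.reindex) auto
  have "(\<Sum>e\<in>arcs Q. ?\<phi> e) = (\<Sum>e\<in>arcs Q - d ` I. ?\<phi> e) + (\<Sum>e\<in>d ` I. ?\<phi> e)"
    using emb by (intro sum.subset_diff) auto
  then show ?thesis unfolding sum_mult_cartan using 1 2 by simp
qed

text \<open>
  The two analytic situations produced by a frieze, see
  \<open>bounded_frieze_imp_strictly_subadditive\<close> and
  \<open>unbounded_rational_frieze_imp_almost_additive\<close>.
\<close>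
definition strictly_subadditive :: bool where
  "strictly_subadditive \<longleftrightarrow> (\<exists>f. \<forall>v\<in>verts Q. f v \<ge> 0 \<and> cartan f v > 0)"

definition almost_additive :: bool where
  "almost_additive \<longleftrightarrow> (\<forall>R. \<exists>f. \<forall>v\<in>verts Q. f v \<ge> R \<and> \<bar>cartan f v\<bar> \<le> 1)"

lemma strictly_subadditive_test:
  assumes "strictly_subadditive" "\<And>v. g v \<ge> 0" "v0 \<in> verts Q" "g v0 > 0"
  obtains f where "\<And>v. v \<in> verts Q \<Longrightarrow> f v \<ge> 0" "(\<Sum>v\<in>verts Q. g v * cartan f v) > 0"
proof -
  obtain f where f: "\<And>v. v \<in> verts Q \<Longrightarrow> f v \<ge> 0 \<and> cartan f v > 0"
    using assms(1) unfolding strictly_subadditive_def by blast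
  have "(\<Sum>v\<in>verts Q. g v * cartan f v) > 0"
  proof (rule sum_pos2[OF _ assms(3)])
    show "0 \<le> g v * cartan f v" if "v \<in> verts Q" for v
      using f[OF that] assms(2)[of v] by simp
  qed (use f assms in auto)
  then show ?thesis using that f by blast
qed

lemma almost_additive_test:
  assumes "almost_additive" "\<And>v. g v \<ge> 0"
  obtains f where "\<And>v. v \<in> verts Q \<Longrightarrow> f v \<ge> R"
    "\<bar>\<Sum>v\<in>verts Q. g v * cartan f v\<bar> \<le> (\<Sum>v\<in>verts Q. g v)"
proof -
  obtain f where f: "\<And>v. v \<in> verts Q \<Longrightarrow> f v \<ge> R \<and> \<bar>cartan f v\<bar> \<le> 1"
    using assms(1) unfolding almost_additive_def by meson
  have "\<bar>\<Sum>v\<in>verts Q. g v * cartan f v\<bar> \<le> (\<Sum>v\<in>verts Q. \<bar>g v * cartan f v\<bar>)" by (rule sum_abs)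
  also have "\<dots> \<le> (\<Sum>v\<in>verts Q. g v)"
    using f assms(2) by (intro sum_mono) (auto simp: abs_mult intro: mult_left_le)
  finally show ?thesis using that f by blast
qed

text \<open>
  The hypothesis on \<open>G\<close> says that it is additive: twice its value at a vertex is the sum over the
  neighbours. So the bilinear form of the diagram vanishes, and only the correction by the
  remaining arcs is left. It is non-positive, which excludes strict subadditivity. In the almost
  additive situation it is bounded, but any remaining arc at a vertex of the diagram would make it
  arbitrarily large; therefore the diagram is everything.
\<close>
lemma additive_embedding:
  assumes emb: "embedding J I x y h d" and "J \<noteq> {}"
    and ge1: "\<And>j. j \<in> J \<Longrightarrow> G j \<ge> (1 :: real)"
    and additive: "\<And>F :: 'j \<Rightarrow> real.
      (\<Sum>j\<in>J. 2 * G j * F j) = (\<Sum>i\<in>I. G (x i) * F (y i) + G (y i) * F (x i))"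
  shows "\<not> strictly_subadditive"
    and "almost_additive \<Longrightarrow> underlying_graph Q \<cong>\<^sub>M (J, {# {x i, y i}. i \<in># mset_set I #})"
proof -
  define g where "g = extend_zero J h G"
  note E = emb[unfolded embedding_def]
  have g: "g v \<ge> 1" if "v \<in> h ` J" for v
    using that E ge1 by (auto simp: g_def extend_zero_def the_inv_into_f_f)
  have g0: "g v \<ge> 0" for v
  proof (cases "v \<in> h ` J")
    case True
    then show ?thesis using g[of v] by simp
  qed (simp add: g_def extend_zero_def)
  define \<phi> where "\<phi> f e = g (head Q e) * f (tail Q e) + g (tail Q e) * f (head Q e)" for f e
  have form: "(\<Sum>v\<in>verts Q. g v * cartan f v) = - (\<Sum>e\<in>arcs Q - d ` I. \<phi> f e)" for f
    unfolding sum_extend_zero_mult_cartan[OF emb g_def] \<phi>_def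
    using additive[of "\<lambda>j. f (h j)"] by simp
  have \<phi>: "\<phi> f e \<ge> 0" if "e \<in> arcs Q" "\<And>v. v \<in> verts Q \<Longrightarrow> f v \<ge> 0" for f e
    unfolding \<phi>_def using that g0 by simp
  obtain v0 where v0: "v0 \<in> h ` J" using \<open>J \<noteq> {}\<close> by blast
  show "\<not> strictly_subadditive"
  proof
    assume sub: "strictly_subadditive"
    have "v0 \<in> verts Q" "g v0 > 0" using E v0 g[OF v0] by auto
    then obtain f where f: "\<And>v. v \<in> verts Q \<Longrightarrow> f v \<ge> 0"
        "(\<Sum>v\<in>verts Q. g v * cartan f v) > 0"
      by (rule strictly_subadditive_test[OF sub g0]) blast
    have "(\<Sum>e\<in>arcs Q - d ` I. \<phi> f e) \<ge> 0" by (intro sum_nonneg \<phi> f) auto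
    then show False using f(2) form[of f] by simp
  qed
  assume aa: "almost_additive"
  have outside: "e \<in> d ` I" if e: "e \<in> arcs Q" and u: "u \<in> ends e" "u \<in> h ` J" for e u
  proof (rule ccontr)
    assume "e \<notin> d ` I"
    define K where "K = (\<Sum>v\<in>verts Q. g v)"
    have "K \<ge> 0" unfolding K_def by (intro sum_nonneg g0)
    obtain f where f: "\<And>v. v \<in> verts Q \<Longrightarrow> f v \<ge> K + 1"
      and le: "\<bar>\<Sum>v\<in>verts Q. g v * cartan f v\<bar> \<le> K"
      unfolding K_def by (rule almost_additive_test[of g "(\<Sum>v\<in>verts Q. g v) + 1", OF aa g0]) blast
    have f0: "f v \<ge> 0" if "v \<in> verts Q" for v using f[OF that] \<open>K \<ge> 0\<close> by simp
    have big: "g u * f w \<ge> K + 1" if "w \<in> verts Q" for w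
      using mult_mono[OF g[OF u(2)] f[OF that]] \<open>K \<ge> 0\<close> g0[of u] by simp
    have "K + 1 \<le> \<phi> f e"
    proof (cases "u = tail Q e")
      case True
      moreover have "g (head Q e) * f (tail Q e) \<ge> 0" using e f0 g0 by simp
      ultimately show ?thesis using big[OF head_in_verts[OF e]] by (simp add: \<phi>_def)
    next
      case False
      then have "u = head Q e" using u(1) by (simp add: ends_def)
      moreover have "g (tail Q e) * f (head Q e) \<ge> 0" using e f0 g0 by simp
      ultimately show ?thesis using big[OF tail_in_verts[OF e]] by (simp add: \<phi>_def)
    qed
    also have "\<dots> \<le> (\<Sum>e\<in>arcs Q - d ` I. \<phi> f e)"
      using e \<open>e \<notin> d ` I\<close> by (intro member_le_sum \<phi> f0) auto
    finally show False using le form[of f] by simp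
  qed
  have "h ` J = verts Q"
  proof (rule adjacent_closed_imp_all)
    fix u v assume u: "u \<in> h ` J" and "adjacent u v"
    then obtain e where e: "e \<in> arcs Q" "ends e = {u, v}" unfolding adjacent_def by blast
    then obtain i where "i \<in> I" "e = d i" using outside[of e u] u by blast
    then have "v \<in> {h (x i), h (y i)}" "x i \<in> J" "y i \<in> J" using e E by auto
    then show "v \<in> h ` J" by blast
  qed (use E v0 in auto)
  moreover have "d ` I = arcs Q"
  proof
    show "arcs Q \<subseteq> d ` I"
    proof
      fix e assume e: "e \<in> arcs Q"
      then show "e \<in> d ` I" using outside[of e "tail Q e"] \<open>h ` J = verts Q\<close> by (simp add: ends_def)
    qed
  qed (use E in auto)
  ultimately show "underlying_graph Q \<cong>\<^sub>M (J, {# {x i, y i}. i \<in># mset_set I #})"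
    by (rule surjective_embedding_imp_iso[OF emb])
qed

end


section \<open>Cycles and forks\<close>

lemma successively_nth:
  "successively P xs \<Longrightarrow> Suc i < length xs \<Longrightarrow> P (xs ! i) (xs ! Suc i)"
proof (induction P xs arbitrary: i rule: successively.induct)
  case (3 P x y xs)
  then show ?case by (cases i) auto
qed auto

lemma successivelyI_nth:
  "(\<And>i. Suc i < length xs \<Longrightarrow> P (xs ! i) (xs ! Suc i)) \<Longrightarrow> successively P xs"
proof (induction P xs rule: successively.induct)
  case (3 P x y xs)
  have "P x y" using "3.prems"[of 0] by simp
  moreover have "successively P (y # xs)" using "3.prems"[of "Suc _"] by (intro "3.IH") auto
  ultimately show ?case by simp
qed auto

context connected_multigraph
begin

text \<open>
  What an embedded extended Dynkin diagram implies: the first analytic situation is impossible, and in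
  the second one the diagram is the whole graph.
\<close>
definition extended_case :: bool where
  "extended_case \<longleftrightarrow> \<not> strictly_subadditive
     \<and> (almost_additive \<longrightarrow> extended_dynkin_diagram (underlying_graph Q))"

text \<open>
  Every vertex of a cycle has two neighbours in it, so the constant function \<open>1\<close> is additive. For
  \<open>n = 2\<close> this is a double edge.
\<close>
lemma embedded_cycle:
  fixes n :: nat
  assumes emb: "embedding {..<n} {..<n} (\<lambda>i. i) (\<lambda>i. (i + 1) mod n) h d" and n: "n \<ge> 2"
  shows extended_case
proof -
  obtain m where m: "n = Suc m" using n by (cases n) auto
  have "(\<Sum>i<n. F ((i + 1) mod n)) = (\<Sum>i<n. F i)" for F :: "nat \<Rightarrow> real"
  proof -
    have "(\<Sum>i<n. F ((i + 1) mod n)) = (\<Sum>i<m. F (Suc i)) + F 0" by (simp add: m)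
    also have "\<dots> = (\<Sum>i<n. F i)" unfolding m by (simp add: sum.lessThan_Suc_shift del: sum.lessThan_Suc)
    finally show ?thesis .
  qed
  then have add: "(\<Sum>j<n. 2 * 1 * F j) = (\<Sum>i<n. 1 * F ((i + 1) mod n) + 1 * F i)"
    for F :: "nat \<Rightarrow> real"
    by (simp add: sum.distrib flip: sum_distrib_left)
  have ne: "{..<n} \<noteq> {}" using n by (simp add: lessThan_empty_iff)
  have "\<exists>k\<ge>1. n = k + 1" using n by (intro exI[of _ "n - 1"]) auto
  then show ?thesis
    using additive_embedding[OF emb ne _ add]
    unfolding extended_case_def extended_dynkin_diagram_def cycle_diagram_def by auto
qed

lemma double_edge:
  assumes "e \<in> arcs Q" "e' \<in> arcs Q" "e \<noteq> e'" "ends e = ends e'"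
  shows extended_case
proof (rule embedded_cycle)
  let ?h = "\<lambda>i::nat. if i = 0 then tail Q e else head Q e"
  let ?d = "\<lambda>i::nat. if i = 0 then e else e'"
  have two: "{..<2} = {0, 1::nat}" by auto
  have "ends e = {tail Q e, head Q e}" "ends e' = {head Q e, tail Q e}"
    using assms(4) by (auto simp: ends_def)
  moreover have "tail Q e \<in> verts Q" "head Q e \<in> verts Q" "tail Q e \<noteq> head Q e"
    using assms(1) no_loop by auto
  ultimately show "embedding {..<2} {..<2} (\<lambda>i. i) (\<lambda>i. (i + 1) mod 2) ?h ?d"
    using assms(1-3) unfolding embedding_def two by simp
qed simp

lemma long_cycle:
  assumes len: "length xs \<ge> 3" and "distinct xs" "set xs \<subseteq> verts Q"
    and adj: "successively adjacent xs" "adjacent (last xs) (hd xs)"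
  shows extended_case
proof -
  let ?n = "length xs"
  have "\<exists>d. embedding {..<?n} {..<?n} (\<lambda>i. i) (\<lambda>i. (i + 1) mod ?n) ((!) xs) d"
  proof (rule embedding_of_adjacent)
    show "inj_on (\<lambda>i. {i, (i + 1) mod ?n}) {..<?n}"
      using len by (intro inj_onI) (auto simp: doubleton_eq_iff mod_Suc split: if_splits)
    show "inj_on ((!) xs) {..<?n}" using assms(2) by (simp add: inj_on_nth)
    fix i assume i: "i \<in> {..<?n}"
    have "adjacent (xs ! i) (xs ! ((i + 1) mod ?n))"
    proof (cases "Suc i = ?n")
      case True
      then have "i = ?n - 1" "xs \<noteq> []" by auto
      then have "xs ! i = last xs" "xs ! 0 = hd xs"
        by (simp_all add: last_conv_nth hd_conv_nth)
      then show ?thesis using True adj(2) by simp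
    next
      case False
      then show ?thesis using successively_nth[OF adj(1), of i] i by simp
    qed
    then show "i \<in> {..<?n} \<and> (i + 1) mod ?n \<in> {..<?n} \<and> adjacent (xs ! i) (xs ! ((i + 1) mod ?n))"
      using i by (auto intro: mod_less_divisor)
  qed (use assms in auto)
  then obtain d where "embedding {..<?n} {..<?n} (\<lambda>i. i) (\<lambda>i. (i + 1) mod ?n) ((!) xs) d" ..
  then show ?thesis by (rule embedded_cycle) (use len in simp)
qed

text \<open>
  With the numbering of \<^const>\<open>extended_D_diagram\<close> for \<open>n = m + 4\<close>, the edges join each positive
  \<open>Suc i\<close> to one smaller vertex, its \<open>parent\<close>. The additive function is \<open>2\<close> on the path and \<open>1\<close> on
  the four leaves.
\<close>
lemma fork:
  assumes P: "P \<noteq> []" and dist: "distinct (P @ [a, b, c, d])" and V: "set (P @ [a, b, c, d]) \<subseteq> verts Q"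
    and adj: "successively adjacent P"
      "adjacent (hd P) a" "adjacent (hd P) b" "adjacent (last P) c" "adjacent (last P) d"
  shows extended_case
proof -
  define m where "m = length P - 1"
  have len: "length P = Suc m" using P by (cases P) (auto simp: m_def)
  define parent where "parent i = (if i < m then i else if i < m + 2 then 0 else m)" for i
  define G :: "nat \<Rightarrow> real" where "G j = (if j \<le> m then 2 else 1)" for j
  define h where "h = (!) (P @ [a, b, c, d])"
  have h: "h 0 = hd P" "h m = last P" "h (m + 1) = a" "h (m + 2) = b" "h (m + 3) = c" "h (m + 4) = d"
    using P by (auto simp: h_def nth_append len hd_conv_nth last_conv_nth)
  have J: "{..m + 4} = {..<length (P @ [a, b, c, d])}" using len by auto
  have "\<exists>e. embedding {..m + 4} {..<m + 4} parent Suc h e"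
  proof (rule embedding_of_adjacent)
    show "inj_on h {..m + 4}" unfolding J h_def by (rule inj_on_nth[OF dist]) auto
    show "h ` {..m + 4} \<subseteq> verts Q" using V unfolding J h_def by (auto simp del: length_append set_append
        dest: nth_mem)
    show "inj_on (\<lambda>i. {parent i, Suc i}) {..<m + 4}"
    proof (rule inj_onI)
      fix i j assume "{parent i, Suc i} = {parent j, Suc j}"
      moreover have "parent i \<le> i" "parent j \<le> j" by (auto simp: parent_def)
      ultimately show "i = j" by (auto simp: doubleton_eq_iff)
    qed
    fix i assume i: "i \<in> {..<m + 4}"
    have "adjacent (h (parent i)) (h (Suc i))"
    proof (cases "i < m")
      case True
      then show ?thesis
        using successively_nth[OF adj(1), of i] len by (simp add: h_def parent_def nth_append)
    next
      case False
      then consider "i = m" | "i = m + 1" | "i = m + 2" | "i = m + 3" using i by force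
      then show ?thesis using adj h by cases (auto simp: parent_def numeral_eq_Suc)
    qed
    then show "parent i \<in> {..m + 4} \<and> Suc i \<in> {..m + 4} \<and> adjacent (h (parent i)) (h (Suc i))"
      using i by (auto simp: parent_def)
  qed auto
  then obtain e where emb: "embedding {..m + 4} {..<m + 4} parent Suc h e" ..
  have path: "(\<Sum>i<k. F (Suc i) + F i) + F 0 + F k = 2 * (\<Sum>j\<le>k. F j)" for F :: "nat \<Rightarrow> real" and k
    by (induction k) auto
  have four: "{..<m + 4} = insert (m + 3) (insert (m + 2) (insert (m + 1) (insert m {..<m})))"
    by auto
  have four': "{..m + 4} = insert (m + 4) (insert (m + 3) (insert (m + 2) (insert (m + 1) {..m})))"
    by auto
  have add: "(\<Sum>j\<le>m + 4. 2 * G j * F j) = (\<Sum>i<m + 4. G (parent i) * F (Suc i) + G (Suc i) * F (parent i))"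
    for F :: "nat \<Rightarrow> real"
  proof -
    have "(\<Sum>j\<le>m. 2 * G j * F j) = 4 * (\<Sum>j\<le>m. F j)"
      unfolding sum_distrib_left by (intro sum.cong) (auto simp: G_def)
    moreover have "(\<Sum>i<m. G (parent i) * F (Suc i) + G (Suc i) * F (parent i))
        = 2 * (\<Sum>i<m. F (Suc i) + F i)"
      unfolding sum_distrib_left by (intro sum.cong) (auto simp: G_def parent_def)
    ultimately show ?thesis unfolding four four'
      using path[of F m] by (simp add: G_def parent_def numeral_eq_Suc)
  qed
  have "extended_D_diagram (m + 4) = ({..m + 4}, {# {parent i, Suc i}. i \<in># mset_set {..<m + 4} #})"
  proof -
    have "{# {parent i, Suc i}. i \<in># mset_set {..<m} #} = {# {i, i + 1}. i \<in># mset_set {..<m} #}"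
      by (intro image_mset_cong) (auto simp: parent_def)
    then show ?thesis unfolding four extended_D_diagram_def
      by (simp add: parent_def numeral_eq_Suc)
  qed
  then have "almost_additive \<Longrightarrow> underlying_graph Q \<cong>\<^sub>M extended_D_diagram (m + 4)"
    using additive_embedding(2)[OF emb _ _ add] by (simp add: G_def)
  then have "almost_additive \<Longrightarrow> \<exists>n\<ge>4. underlying_graph Q \<cong>\<^sub>M extended_D_diagram n"
    by (intro exI[of _ "m + 4"]) simp
  moreover have "\<not> strictly_subadditive"
    using additive_embedding(1)[OF emb _ _ add] by (simp add: G_def)
  ultimately show ?thesis unfolding extended_case_def extended_dynkin_diagram_def by blast
qed

end

section \<open>Maximal tripods\<close>

fun path_edges :: "'a list \<Rightarrow> 'a set set" where
  "path_edges (x # y # zs) = insert {x, y} (path_edges (y # zs))"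
| "path_edges _ = {}"

lemma path_edges_append:
  "path_edges (xs @ c # ys) = path_edges (xs @ [c]) \<union> path_edges (c # ys)"
proof (induction xs)
  case (Cons x xs)
  then show ?case by (cases xs) auto
qed simp

lemma path_edges_rev: "path_edges (rev xs) = path_edges xs"
proof (induction xs rule: path_edges.induct)
  case (1 x y zs)
  then show ?case using path_edges_append[of "rev zs" y "[x]"] by (auto simp: insert_commute)
qed auto

lemma path_edges_conv_nth:
  "path_edges xs = (\<lambda>i. {xs ! i, xs ! Suc i}) ` {..<length xs - 1}"
proof (induction xs rule: path_edges.induct)
  case (1 x y zs)
  have "{..<length (x # y # zs) - 1} = insert 0 (Suc ` {..<length (y # zs) - 1})"
    by (simp add: lessThan_Suc_eq_insert_0)
  then show ?case using 1 by (simp add: image_image)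
qed auto

lemma successively_append_Cons:
  "successively P (xs @ u # ys) \<longleftrightarrow> successively P (xs @ [u]) \<and> successively P (u # ys)"
  by (auto simp: successively_append_iff successively_Cons)

context connected_multigraph
begin

text \<open>
  Arms may be empty, so that a path, and even a single vertex, is a tripod. One maximality argument
  then covers every graph without a cycle or a fork.
\<close>
definition tripod :: "'v \<Rightarrow> 'v list \<Rightarrow> 'v list \<Rightarrow> 'v list \<Rightarrow> bool" where
  "tripod c xs ys zs \<longleftrightarrow> distinct (c # xs @ ys @ zs) \<and> set (c # xs @ ys @ zs) \<subseteq> verts Q
     \<and> successively adjacent (c # xs) \<and> successively adjacent (c # ys)
     \<and> successively adjacent (c # zs)"

lemma tripod_swap: "tripod c xs ys zs \<Longrightarrow> tripod c ys xs zs"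
  unfolding tripod_def by auto

lemma tripod_rotate: "tripod c xs ys zs \<Longrightarrow> tripod c ys zs xs"
  unfolding tripod_def by auto

lemma chord_closes_cycle:
  assumes P: "distinct P" "set P \<subseteq> verts Q" "successively adjacent P"
    and uv: "u \<in> set P" "v \<in> set P" "adjacent u v"
  shows "{u, v} \<in> path_edges P \<or> extended_case"
proof -
  have *: "{P ! i, P ! j} \<in> path_edges P \<or> extended_case"
    if ij: "i < j" "j < length P" "adjacent (P ! i) (P ! j)" for i j
  proof (cases "j = Suc i")
    case True
    then show ?thesis using ij by (auto simp: path_edges_conv_nth)
  next
    case False
    define xs where "xs = take (Suc j - i) (drop i P)"
    have len: "length xs = Suc j - i" using ij by (simp add: xs_def)
    have nth: "xs ! k = P ! (i + k)" if "k < length xs" for k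
      using that len ij by (simp add: xs_def)
    have "xs \<noteq> []" using len ij by auto
    have extended_case
    proof (rule long_cycle)
      show "3 \<le> length xs" using len ij False by simp
      show "distinct xs" using P by (simp add: xs_def)
      show "set xs \<subseteq> verts Q"
        using P(2) set_take_subset[of "Suc j - i" "drop i P"] set_drop_subset[of i P]
        by (auto simp: xs_def)
      show "successively adjacent xs"
        using successively_nth[OF P(3)] nth len ij by (intro successivelyI_nth) simp
      have "last xs = P ! j" "hd xs = P ! i"
        using nth[of "length xs - 1"] nth[of 0] len ij \<open>xs \<noteq> []\<close>
        by (auto simp: last_conv_nth hd_conv_nth)
      then show "adjacent (last xs) (hd xs)" using ij by (simp add: adjacent_sym)
    qed
    then show ?thesis ..
  qed
  obtain i j where ij: "i < length P" "j < length P" "u = P ! i" "v = P ! j"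
    using uv by (metis in_set_conv_nth)
  have "i \<noteq> j" using adjacent_neq[OF uv(3)] ij by auto
  then consider "i < j" | "j < i" by linarith
  then show ?thesis
  proof cases
    case 1
    then show ?thesis using *[of i j] ij uv by simp
  next
    case 2
    then show ?thesis using *[of j i] ij uv by (simp add: adjacent_sym insert_commute)
  qed
qed

lemma tripod_path:
  assumes "tripod c xs ys zs"
  shows "distinct (rev xs @ c # ys)" "set (rev xs @ c # ys) \<subseteq> verts Q"
    "successively adjacent (rev xs @ c # ys)"
proof -
  have *: "(\<lambda>x y. adjacent y x) = adjacent" using adjacent_sym by blast
  show "successively adjacent (rev xs @ c # ys)"
    using assms adjacent_sym unfolding tripod_def
    by (auto simp: successively_append_iff successively_Cons * last_rev)
qed (use assms in \<open>auto simp: tripod_def\<close>)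

lemma tripod_adjacent_pair:
  assumes "\<not> extended_case" "tripod c xs ys zs"
    and "u \<in> set (c # xs @ ys)" "v \<in> set (c # xs @ ys)" "adjacent u v"
  shows "{u, v} \<in> path_edges (c # xs) \<union> path_edges (c # ys)"
proof -
  have "{u, v} \<in> path_edges (rev xs @ c # ys)"
    using chord_closes_cycle[OF tripod_path[OF assms(2)], of u v] assms by auto
  also have "\<dots> = path_edges (rev (c # xs)) \<union> path_edges (c # ys)"
    by (subst path_edges_append) simp
  finally show ?thesis unfolding path_edges_rev .
qed

text \<open>
  Any two vertices of a tripod lie on a path through the centre that consists of two of the arms, and
  an edge that joins them without belonging to this path would close a cycle.
\<close>
lemma tripod_adjacent:
  assumes "\<not> extended_case" and t: "tripod c xs ys zs"
    and uv: "u \<in> set (c # xs @ ys @ zs)" "v \<in> set (c # xs @ ys @ zs)" "adjacent u v"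
  shows "{u, v} \<in> path_edges (c # xs) \<union> path_edges (c # ys) \<union> path_edges (c # zs)"
proof -
  have t2: "tripod c ys zs xs" "tripod c zs xs ys" using t tripod_rotate by blast+
  consider "{u, v} \<subseteq> set (c # xs @ ys)" | "{u, v} \<subseteq> set (c # ys @ zs)" | "{u, v} \<subseteq> set (c # zs @ xs)"
    using uv by fastforce
  then show ?thesis
  proof cases
    case 1
    then show ?thesis using tripod_adjacent_pair[OF assms(1) t, of u v] uv by auto
  next
    case 2
    then show ?thesis using tripod_adjacent_pair[OF assms(1) t2(1), of u v] uv by auto
  next
    case 3
    then show ?thesis using tripod_adjacent_pair[OF assms(1) t2(2), of u v] uv by auto
  qed
qed

text \<open>
  A vertex \<open>x\<close> attached to the end of an arm prolongs it. Attached to an inner vertex \<open>u\<close> of an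
  arm, it creates a second branching, unless one of the other arms is empty: then \<open>u\<close> is the
  centre of a larger tripod with \<open>x\<close> as one of its arms.
\<close>
lemma tripod_attach_arm:
  assumes ne: "\<not> extended_case" and t: "tripod c xs ys zs"
    and u: "u \<in> set xs" and x: "x \<in> verts Q" "x \<notin> set (c # xs @ ys @ zs)" "adjacent u x"
  shows "\<exists>c' xs' ys' zs'. tripod c' xs' ys' zs'
    \<and> length xs + length ys + length zs < length xs' + length ys' + length zs'"
proof -
  obtain as bs where xs: "xs = as @ u # bs" using u by (meson split_list)
  have sym: "(\<lambda>x y. adjacent y x) = adjacent" using adjacent_sym by blast
  have ux: "adjacent x u" using x adjacent_sym by blast
  note T = t[unfolded tripod_def xs]
  have "successively adjacent ((c # as) @ u # bs)" using T by simp
  then have asu: "successively adjacent (c # as @ [u])" and ubs: "successively adjacent (u # bs)"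
    unfolding successively_append_Cons[of _ "c # as" u bs] by simp_all
  have rev: "successively adjacent (u # rev as @ c # ws)" if "successively adjacent (c # ws)" for ws
  proof -
    have "successively adjacent (rev (c # as @ [u]))" unfolding successively_rev sym by (rule asu)
    then show ?thesis using that successively_append_Cons[of adjacent "u # rev as" c ws] by simp
  qed
  show ?thesis
  proof (cases "bs = []")
    case True
    have "successively adjacent (c # xs @ [x])"
      using asu x True successively_append_Cons[of adjacent "c # as" u "[x]"] by (simp add: xs)
    then have "tripod c (xs @ [x]) ys zs" using t x unfolding tripod_def by auto
    then show ?thesis by (intro exI) auto
  next
    case bs: False
    show ?thesis
    proof (cases "ys = [] \<or> zs = []")
      case True
      have "\<exists>ws. tripod u [x] bs (rev as @ c # ws) \<and> length ws = length ys + length zs"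
      proof (rule disjE[OF True])
        assume "ys = []"
        then show ?thesis using T x[unfolded xs] ux ubs rev[of zs] adjacent_neq[OF ux]
          unfolding tripod_def by (intro exI[of _ zs]) auto
      next
        assume "zs = []"
        then show ?thesis using T x[unfolded xs] ux ubs rev[of ys] adjacent_neq[OF ux]
          unfolding tripod_def by (intro exI[of _ ys]) auto
      qed
      then obtain ws where "tripod u [x] bs (rev as @ c # ws)" "length ws = length ys + length zs"
        by blast
      then show ?thesis unfolding xs by (intro exI conjI) (assumption, simp)
    next
      case False
      then obtain y ys' z zs' b bs' where heads: "ys = y # ys'" "zs = z # zs'" "bs = b # bs'"
        using bs by (meson neq_Nil_conv)
      have extended_case
      proof (rule fork[of "c # as @ [u]" y z x b])
        show "distinct ((c # as @ [u]) @ [y, z, x, b])" using T x unfolding heads xs by auto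
      qed (use T x asu ubs heads in auto)
      then show ?thesis using ne by blast
    qed
  qed
qed

lemma tripod_attach:
  assumes ne: "\<not> extended_case" and t: "tripod c xs ys zs"
    and u: "u \<in> set (c # xs @ ys @ zs)"
    and x: "x \<in> verts Q" "x \<notin> set (c # xs @ ys @ zs)" "adjacent u x"
  shows "\<exists>c' xs' ys' zs'. tripod c' xs' ys' zs'
    \<and> length xs + length ys + length zs < length xs' + length ys' + length zs'"
proof -
  have t2: "tripod c ys zs xs" "tripod c zs xs ys" using t tripod_rotate by blast+
  consider "u = c" | "u \<in> set xs" | "u \<in> set ys" | "u \<in> set zs" using u by auto
  then show ?thesis
  proof cases
    case 1
    have new: "tripod c [x] B C" if "tripod c A B C" "set A \<union> set B \<union> set C \<subseteq> set (xs @ ys @ zs)" for A B C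
      using that x 1 unfolding tripod_def by auto
    show ?thesis
    proof (cases "xs = [] \<or> ys = [] \<or> zs = []")
      case True
      then show ?thesis
      proof (elim disjE)
        assume "xs = []"
        then show ?thesis using new[OF t] by (intro exI[of _ c] exI[of _ "[x]"] exI conjI) auto
      next
        assume "ys = []"
        then show ?thesis using new[OF t2(1)] by (intro exI[of _ c] exI[of _ "[x]"] exI conjI) auto
      next
        assume "zs = []"
        then show ?thesis using new[OF t2(2)] by (intro exI[of _ c] exI[of _ "[x]"] exI conjI) auto
      qed
    next
      case False
      have extended_case
      proof (rule fork[of "[c]" "hd xs" "hd ys" "hd zs" x])
        show "distinct ([c] @ [hd xs, hd ys, hd zs, x])" "set ([c] @ [hd xs, hd ys, hd zs, x]) \<subseteq> verts Q"
          using t x False unfolding tripod_def by (auto dest: hd_in_set)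
      qed (use t x False 1 in \<open>auto simp: tripod_def successively_Cons\<close>)
      then show ?thesis using ne by blast
    qed
  next
    case 2
    then show ?thesis using tripod_attach_arm[OF ne t] x by blast
  next
    case 3
    then show ?thesis using tripod_attach_arm[OF ne t2(1), of u x] x by (auto simp: add_ac)
  next
    case 4
    then show ?thesis using tripod_attach_arm[OF ne t2(2), of u x] x by (auto simp: add_ac)
  qed
qed

text \<open>
  The inclusion of edges is an equality, since the arms are paths of the graph.
\<close>
definition spanning_tripod :: "'v \<Rightarrow> 'v list \<Rightarrow> 'v list \<Rightarrow> 'v list \<Rightarrow> bool" where
  "spanning_tripod c xs ys zs \<longleftrightarrow> tripod c xs ys zs \<and> set (c # xs @ ys @ zs) = verts Q
     \<and> inj_on ends (arcs Q)
     \<and> ends ` arcs Q \<subseteq> path_edges (c # xs) \<union> path_edges (c # ys) \<union> path_edges (c # zs)"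

lemma spanning_tripod_swap: "spanning_tripod c xs ys zs \<Longrightarrow> spanning_tripod c ys xs zs"
  unfolding spanning_tripod_def using tripod_swap by auto

lemma spanning_tripod_rotate: "spanning_tripod c xs ys zs \<Longrightarrow> spanning_tripod c ys zs xs"
  unfolding spanning_tripod_def using tripod_rotate by auto

text \<open>A tripod of maximal size spans, since any further vertex could be attached to it.\<close>
theorem extended_or_spanning_tripod:
  assumes ne: "\<not> extended_case"
  obtains c xs ys zs where "spanning_tripod c xs ys zs"
    "length xs \<le> length ys" "length ys \<le> length zs"
proof -
  define size where "size = (\<lambda>(c :: 'v, xs :: 'v list, ys :: 'v list, zs :: 'v list).
    length xs + length ys + length zs)"
  define T where "T = (\<lambda>(c, xs, ys, zs). tripod c xs ys zs)"
  obtain v where "v \<in> verts Q" using verts_nonempty by blast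
  then have T0: "T (v, [], [], [])" by (simp add: T_def tripod_def)
  have "\<forall>p. T p \<longrightarrow> size p < card (verts Q)"
  proof (intro allI impI)
    fix p assume "T p"
    then obtain c xs ys zs where p: "p = (c, xs, ys, zs)" and t: "tripod c xs ys zs"
      by (cases p) (auto simp: T_def)
    have "length (c # xs @ ys @ zs) \<le> card (verts Q)"
      using t unfolding tripod_def by (metis card_mono distinct_card finite_verts)
    then show "size p < card (verts Q)" by (simp add: p size_def)
  qed
  from ex_has_greatest_nat[OF T0 this] obtain c xs ys zs where t: "tripod c xs ys zs"
    and max: "\<And>c' xs' ys' zs'. tripod c' xs' ys' zs' \<Longrightarrow>
      length xs' + length ys' + length zs' \<le> length xs + length ys + length zs"
    by (auto simp: T_def size_def)
  have span: "set (c # xs @ ys @ zs) = verts Q"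
  proof (rule adjacent_closed_imp_all)
    show "set (c # xs @ ys @ zs) \<subseteq> verts Q" using t by (simp add: tripod_def)
    fix u x assume "u \<in> set (c # xs @ ys @ zs)" "adjacent u x"
    then show "x \<in> set (c # xs @ ys @ zs)"
      using tripod_attach[OF ne t] max adjacent_in_verts by (meson not_le)
  qed simp
  have "inj_on ends (arcs Q)" using double_edge ne by (auto simp: inj_on_def)
  moreover have "ends e \<in> path_edges (c # xs) \<union> path_edges (c # ys) \<union> path_edges (c # zs)"
    if e: "e \<in> arcs Q" for e
    unfolding ends_def using tripod_adjacent[OF ne t] adjacent_arc[OF e] e unfolding span by simp
  ultimately have s: "spanning_tripod c xs ys zs" unfolding spanning_tripod_def using t span by auto
  note perms = s spanning_tripod_swap[OF s] spanning_tripod_rotate[OF s]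
    spanning_tripod_rotate[OF spanning_tripod_rotate[OF s]]
    spanning_tripod_swap[OF spanning_tripod_rotate[OF s]]
    spanning_tripod_rotate[OF spanning_tripod_swap[OF s]]
  show ?thesis
    using that[OF perms(1)] that[OF perms(2)] that[OF perms(3)] that[OF perms(4)]
      that[OF perms(5)] that[OF perms(6)] by linarith
qed

end

section \<open>The bilinear form of a star\<close>

text \<open>
  An affine function satisfies the additivity equation at all inner vertices of a path, so only
  boundary terms remain.
\<close>
lemma affine_path_form:
  fixes F :: "nat \<Rightarrow> real" and \<beta> :: real
  defines "g j \<equiv> 1 - \<beta> * real j"
  shows "(\<Sum>j<k. g j * F (Suc j) + g (Suc j) * F j)
    = (\<Sum>j = 1..k. 2 * g j * F j) + g 1 * F 0 - g (Suc k) * F k"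
  by (induction k) (simp_all add: g_def algebra_simps)

definition star_weight :: "nat list \<Rightarrow> nat \<times> nat \<Rightarrow> real" where
  "star_weight ls = (\<lambda>(i, j). 1 - real j / (real (ls ! i) + 1))"

definition star_vertices :: "nat list \<Rightarrow> (nat \<times> nat) set" where
  "star_vertices ls = {arm_vertex i j | i j. i < length ls \<and> j \<le> ls ! i}"

definition star_edges :: "nat list \<Rightarrow> (nat \<times> nat) set" where
  "star_edges ls = (SIGMA i:{..<length ls}. {..<ls ! i})"

lemma arm_vertex_in_star: "i < length ls \<Longrightarrow> j \<le> ls ! i \<Longrightarrow> arm_vertex i j \<in> star_vertices ls"
  unfolding star_vertices_def by blast

lemma star_vertices_conv:
  assumes "ls \<noteq> []"
  shows "star_vertices ls = insert (0, 0) (SIGMA i:{..<length ls}. {1..ls ! i})"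
proof
  show "star_vertices ls \<subseteq> insert (0, 0) (SIGMA i:{..<length ls}. {1..ls ! i})"
    by (auto simp: star_vertices_def arm_vertex_def split: if_splits)
  have "(0, 0) = arm_vertex 0 0" by (simp add: arm_vertex_def)
  then have "(0, 0) \<in> star_vertices ls" using assms by (simp add: arm_vertex_in_star)
  moreover have "(i, j) \<in> star_vertices ls" if "i < length ls" "1 \<le> j" "j \<le> ls ! i" for i j
    using arm_vertex_in_star[OF that(1,3)] that(2) by (simp add: arm_vertex_def)
  ultimately show "insert (0, 0) (SIGMA i:{..<length ls}. {1..ls ! i}) \<subseteq> star_vertices ls"
    by auto
qed

text \<open>
  The weight is \<open>1\<close> at the centre and decreases linearly along each arm, so as to vanish one step
  beyond its end. Hence the form is concentrated at the centre, where an arm of length \<open>l\<close>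
  contributes \<open>1 - 1 / (l + 1)\<close>. This is where the sum of the reciprocals comes from by which
  Dynkin diagrams are classified.
\<close>
lemma star_form:
  fixes F :: "nat \<times> nat \<Rightarrow> real"
  assumes ne: "ls \<noteq> []" and G_def: "G = star_weight ls"
  shows "(\<Sum>p\<in>star_vertices ls. 2 * G p * F p)
      - (\<Sum>(i, j)\<in>star_edges ls.
          G (arm_vertex i j) * F (arm_vertex i (j + 1)) + G (arm_vertex i (j + 1)) * F (arm_vertex i j))
    = (2 - (\<Sum>l\<leftarrow>ls. 1 - 1 / (real l + 1))) * F (0, 0)"
proof -
  define g where "g i j = 1 - 1 / (real (ls ! i) + 1) * real j" for i j
  have G: "G (arm_vertex i j) = g i j" for i j
    by (auto simp: G_def star_weight_def arm_vertex_def g_def)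
  have "(\<Sum>(i, j)\<in>star_edges ls.
      G (arm_vertex i j) * F (arm_vertex i (j + 1)) + G (arm_vertex i (j + 1)) * F (arm_vertex i j))
    = (\<Sum>i<length ls. \<Sum>j<ls ! i. g i j * F (arm_vertex i (Suc j)) + g i (Suc j) * F (arm_vertex i j))"
    unfolding star_edges_def by (subst sum.Sigma[symmetric]) (auto simp: G)
  also have "\<dots> = (\<Sum>i<length ls. (\<Sum>j = 1..ls ! i. 2 * g i j * F (arm_vertex i j))
      + (1 - 1 / (real (ls ! i) + 1)) * F (0, 0))"
  proof (rule sum.cong[OF refl])
    fix i
    have "g i (Suc (ls ! i)) = 0" by (simp add: g_def field_simps)
    then show "(\<Sum>j<ls ! i. g i j * F (arm_vertex i (Suc j)) + g i (Suc j) * F (arm_vertex i j))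
      = (\<Sum>j = 1..ls ! i. 2 * g i j * F (arm_vertex i j)) + (1 - 1 / (real (ls ! i) + 1)) * F (0, 0)"
      using affine_path_form[where F = "\<lambda>j. F (arm_vertex i j)" and k = "ls ! i"
          and \<beta> = "1 / (real (ls ! i) + 1)"]
      by (simp add: g_def arm_vertex_def)
  qed
  also have "\<dots> = (\<Sum>i<length ls. \<Sum>j = 1..ls ! i. 2 * g i j * F (arm_vertex i j))
      + (\<Sum>l\<leftarrow>ls. 1 - 1 / (real l + 1)) * F (0, 0)"
    by (simp add: sum.distrib sum_list_sum_nth sum_distrib_right atLeast0LessThan)
  finally have I: "(\<Sum>(i, j)\<in>star_edges ls.
      G (arm_vertex i j) * F (arm_vertex i (j + 1)) + G (arm_vertex i (j + 1)) * F (arm_vertex i j))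
    = \<dots>" .
  have "(\<Sum>p\<in>star_vertices ls. 2 * G p * F p) = 2 * G (0, 0) * F (0, 0)
      + (\<Sum>p\<in>(SIGMA i:{..<length ls}. {1..ls ! i}). 2 * G p * F p)"
    unfolding star_vertices_conv[OF ne] by (subst sum.insert) auto
  also have "(\<Sum>p\<in>(SIGMA i:{..<length ls}. {1..ls ! i}). 2 * G p * F p)
      = (\<Sum>i<length ls. \<Sum>j = 1..ls ! i. 2 * G (i, j) * F (i, j))"
    by (subst sum.Sigma) (auto simp: case_prod_unfold)
  also have "\<dots> = (\<Sum>i<length ls. \<Sum>j = 1..ls ! i. 2 * g i j * F (arm_vertex i j))"
    by (intro sum.cong refl) (auto simp: G[symmetric] arm_vertex_def)
  also have "G (0, 0) = 1" by (simp add: G_def star_weight_def)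
  finally show ?thesis using I by (simp add: algebra_simps)
qed


section \<open>Spanning tripods\<close>

context connected_multigraph
begin

lemma spanning_tripod_embedding:
  assumes s: "spanning_tripod c xs ys zs"
    and ls: "ls = [length xs, length ys, length zs]"
    and h_def: "h = (\<lambda>(i, j). (c # [xs, ys, zs] ! i) ! j)"
  obtains d where "embedding (star_vertices ls) (star_edges ls)
      (\<lambda>(i, j). arm_vertex i j) (\<lambda>(i, j). arm_vertex i (j + 1)) h d"
    and "h ` star_vertices ls = verts Q" "d ` star_edges ls = arcs Q"
proof -
  define A where "A i = [xs, ys, zs] ! i" for i
  note T = s[unfolded spanning_tripod_def tripod_def]
  have i3: "i = 0 \<or> i = 1 \<or> i = 2" if "i < 3" for i :: nat using that by auto
  have len: "ls ! i = length (A i)" if "i < 3" for i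
    using i3[OF that] by (auto simp: ls A_def)
  have l3: "length ls = 3" by (simp add: ls)
  have vertex_cases: "\<exists>i j. p = arm_vertex i j \<and> i < 3 \<and> j \<le> length (A i)"
    if p: "p \<in> star_vertices ls" for p
  proof -
    obtain i j where "p = arm_vertex i j" "i < 3" "j \<le> ls ! i"
      using p unfolding star_vertices_def l3 by blast
    then show ?thesis using len[of i] by auto
  qed
  have distA: "distinct (c # A i)" and adjA: "successively adjacent (c # A i)"
    and subA: "set (c # A i) \<subseteq> verts Q" if "i < 3" for i
    using i3[OF that] T by (elim disjE; simp add: A_def)+
  have disjA: "set (A i) \<inter> set (A j) = {}" if "i < 3" "j < 3" "i \<noteq> j" for i j
  proof -
    have "set xs \<inter> set ys = {}" "set xs \<inter> set zs = {}" "set ys \<inter> set zs = {}" using T by auto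
    then show ?thesis
      using i3[OF that(1)] i3[OF that(2)] that(3) by (elim disjE) (simp_all add: A_def Int_commute)
  qed
  have h: "h (arm_vertex i j) = (c # A i) ! j" for i j
    by (auto simp: h_def A_def arm_vertex_def)
  have inj: "inj_on h (star_vertices ls)"
  proof (rule inj_onI)
    fix p q assume "p \<in> star_vertices ls" "q \<in> star_vertices ls" and eq: "h p = h q"
    then obtain i j i' j' where p: "p = arm_vertex i j" "i < 3" "j \<le> length (A i)"
      and q: "q = arm_vertex i' j'" "i' < 3" "j' \<le> length (A i')"
      using vertex_cases by metis
    have e: "(c # A i) ! j = (c # A i') ! j'" using eq by (simp add: p q h)
    show "p = q"
    proof (cases "i = i'")
      case True
      then have "j = j'"
        using e nth_eq_iff_index_eq[OF distA[OF p(2)], of j j'] p(3) q(3) by simp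
      then show ?thesis using True p q by simp
    next
      case False
      have mem: "(c # A k) ! m \<in> set (A k)" if "m \<noteq> 0" "m \<le> length (A k)" for k m
        using that by (cases m) auto
      have c: "c \<notin> set (A i)" "c \<notin> set (A i')" using distA[OF p(2)] distA[OF q(2)] by simp_all
      have "j = 0" using e mem[OF _ p(3)] mem[OF _ q(3)] c disjA[OF p(2) q(2) False]
        by (cases "j' = 0"; cases "j = 0") auto
      moreover have "j' = 0" using e mem[OF _ q(3)] c \<open>j = 0\<close> by (cases "j' = 0") auto
      ultimately show ?thesis by (simp add: p q arm_vertex_def)
    qed
  qed
  have span: "h ` star_vertices ls = verts Q"
  proof
    show "verts Q \<subseteq> h ` star_vertices ls"
    proof
      fix v assume "v \<in> verts Q"
      then have "v \<in> set (c # xs @ ys @ zs)" using T by simp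
      then have "v \<in> set (c # A 0) \<or> v \<in> set (c # A 1) \<or> v \<in> set (c # A 2)"
        by (auto simp: A_def)
      moreover have "0 < (3 :: nat)" "1 < (3 :: nat)" "2 < (3 :: nat)" by simp_all
      ultimately obtain i where i: "i < 3" "v \<in> set (c # A i)" by blast
      then obtain j where j: "j \<le> length (A i)" "v = (c # A i) ! j"
        unfolding in_set_conv_nth by (auto simp: less_Suc_eq_le)
      then have "v = h (arm_vertex i j)" "arm_vertex i j \<in> star_vertices ls"
        using len[OF i(1)] i(1) by (simp_all add: h arm_vertex_in_star l3)
      then show "v \<in> h ` star_vertices ls" by blast
    qed
    show "h ` star_vertices ls \<subseteq> verts Q"
    proof
      fix v assume "v \<in> h ` star_vertices ls"
      then obtain i j where "v = h (arm_vertex i j)" "i < 3" "j \<le> length (A i)"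
        using vertex_cases by blast
      then show "v \<in> verts Q" using subA[of i] nth_mem[of j "c # A i"] by (auto simp: h)
    qed
  qed
  have "\<exists>d. embedding (star_vertices ls) (star_edges ls)
    (\<lambda>(i, j). arm_vertex i j) (\<lambda>(i, j). arm_vertex i (j + 1)) h d"
  proof (rule embedding_of_adjacent)
    have "ls \<noteq> []" by (simp add: ls)
    then show "finite (star_vertices ls)" by (simp add: star_vertices_conv)
    show "finite (star_edges ls)" by (simp add: star_edges_def)
    show "inj_on (\<lambda>k. {(case k of (i, j) \<Rightarrow> arm_vertex i j), (case k of (i, j) \<Rightarrow> arm_vertex i (j + 1))})
        (star_edges ls)"
      by (rule inj_onI) (auto simp: doubleton_eq_iff arm_vertex_def split: if_splits)
    fix k assume "k \<in> star_edges ls"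
    then obtain i j where k: "k = (i, j)" "i < 3" "j < ls ! i"
      unfolding star_edges_def l3 by auto
    then have "adjacent ((c # A i) ! j) ((c # A i) ! Suc j)"
      using len[OF k(2)] by (intro successively_nth[OF adjA]) auto
    then show "(case k of (i, j) \<Rightarrow> arm_vertex i j) \<in> star_vertices ls
      \<and> (case k of (i, j) \<Rightarrow> arm_vertex i (j + 1)) \<in> star_vertices ls
      \<and> adjacent (h (case k of (i, j) \<Rightarrow> arm_vertex i j)) (h (case k of (i, j) \<Rightarrow> arm_vertex i (j + 1)))"
      using k by (simp add: h arm_vertex_in_star l3)
  qed (use inj span in auto)
  then obtain d where emb: "embedding (star_vertices ls) (star_edges ls)
    (\<lambda>(i, j). arm_vertex i j) (\<lambda>(i, j). arm_vertex i (j + 1)) h d" ..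
  have "d ` star_edges ls = arcs Q"
  proof (rule embedding_covers_arcs[OF emb])
    show "inj_on ends (arcs Q)" using T by blast
    have edge: "path_edges (c # A i) \<subseteq> (\<lambda>k. {h (case k of (i, j) \<Rightarrow> arm_vertex i j),
        h (case k of (i, j) \<Rightarrow> arm_vertex i (j + 1))}) ` star_edges ls" if i: "i < 3" for i
    proof
      fix X assume "X \<in> path_edges (c # A i)"
      then obtain j where j: "j < length (A i)" "X = {(c # A i) ! j, (c # A i) ! Suc j}"
        by (auto simp: path_edges_conv_nth)
      have "(i, j) \<in> star_edges ls" using i j len[OF i] by (simp add: star_edges_def l3)
      then show "X \<in> (\<lambda>k. {h (case k of (i, j) \<Rightarrow> arm_vertex i j),
          h (case k of (i, j) \<Rightarrow> arm_vertex i (j + 1))}) ` star_edges ls"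
        by (rule rev_image_eqI) (simp add: h j)
    qed
    have "ends ` arcs Q \<subseteq> path_edges (c # A 0) \<union> path_edges (c # A 1) \<union> path_edges (c # A 2)"
      using T by (simp add: A_def)
    also have "\<dots> \<subseteq> (\<lambda>k. {h (case k of (i, j) \<Rightarrow> arm_vertex i j),
        h (case k of (i, j) \<Rightarrow> arm_vertex i (j + 1))}) ` star_edges ls"
      by (intro Un_least edge) simp_all
    finally show "ends ` arcs Q \<subseteq> \<dots>" .
  qed
  with emb span show ?thesis by (rule that)
qed

lemma spanning_tripod_iso_star:
  assumes "spanning_tripod c xs ys zs"
  shows "underlying_graph Q \<cong>\<^sub>M star_diagram [length xs, length ys, length zs]"
proof -
  define ls where "ls = [length xs, length ys, length zs]"
  define h where "h = (\<lambda>(i, j). (c # [xs, ys, zs] ! i) ! j)"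
  obtain d where "embedding (star_vertices ls) (star_edges ls)
      (\<lambda>(i, j). arm_vertex i j) (\<lambda>(i, j). arm_vertex i (j + 1)) h d"
    "h ` star_vertices ls = verts Q" "d ` star_edges ls = arcs Q"
    by (rule spanning_tripod_embedding[OF assms ls_def h_def])
  from surjective_embedding_imp_iso[OF this] show ?thesis
    unfolding star_diagram_def ls_def[symmetric] star_vertices_def star_edges_def
    by (simp only: case_prod_unfold)
qed

lemma spanning_tripod_iso_path:
  assumes s: "spanning_tripod c [] ys zs"
  shows "underlying_graph Q \<cong>\<^sub>M path_diagram (length ys + length zs + 1)"
proof -
  define P where "P = rev ys @ c # zs"
  have t: "tripod c ys zs []" using s tripod_rotate[of c "[]" ys zs] by (simp add: spanning_tripod_def)
  have path: "distinct P" "successively adjacent P"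
    unfolding P_def by (rule tripod_path[OF t])+
  have "set (c # [] @ ys @ zs) = verts Q" and inj: "inj_on ends (arcs Q)"
    and arcs: "ends ` arcs Q \<subseteq> path_edges [c] \<union> path_edges (c # ys) \<union> path_edges (c # zs)"
    using s unfolding spanning_tripod_def by blast+
  moreover have "set P = set (c # [] @ ys @ zs)" unfolding P_def by auto
  moreover have "(!) P ` {..<length P} = set P" by (auto simp: set_conv_nth)
  ultimately have span: "(!) P ` {..<length P} = verts Q" by (simp only:)
  have "\<exists>d. embedding {..<length P} {..<length P - 1} (\<lambda>i. i) (\<lambda>i. i + 1) ((!) P) d"
  proof (rule embedding_of_adjacent)
    show "inj_on ((!) P) {..<length P}" by (rule inj_on_nth[OF path(1)]) simp
    show "inj_on (\<lambda>i. {i, i + 1}) {..<length P - 1}"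
    proof (rule inj_onI)
      fix i j :: nat assume "{i, i + 1} = {j, j + 1}"
      then show "i = j" by (auto simp: doubleton_eq_iff)
    qed
    show "i \<in> {..<length P} \<and> i + 1 \<in> {..<length P} \<and> adjacent (P ! i) (P ! (i + 1))"
      if "i \<in> {..<length P - 1}" for i
    proof -
      have "Suc i < length P" using that by (simp add: less_diff_conv)
      then show ?thesis using successively_nth[OF path(2), of i] by simp
    qed
  qed (simp_all add: span)
  then obtain d where emb: "embedding {..<length P} {..<length P - 1} (\<lambda>i. i) (\<lambda>i. i + 1) ((!) P) d" ..
  have "d ` {..<length P - 1} = arcs Q"
  proof (rule embedding_covers_arcs[OF emb inj])
    have "ends ` arcs Q \<subseteq> path_edges (rev (c # ys)) \<union> path_edges (c # zs)"
      using arcs unfolding path_edges_rev by simp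
    also have "\<dots> = path_edges P" unfolding P_def by (subst path_edges_append) simp
    finally show "ends ` arcs Q \<subseteq> (\<lambda>i. {P ! i, P ! (i + 1)}) ` {..<length P - 1}"
      unfolding path_edges_conv_nth Suc_eq_plus1 .
  qed
  from surjective_embedding_imp_iso[OF emb span this]
  have "underlying_graph Q \<cong>\<^sub>M path_diagram (length P)" by (simp add: path_diagram_def)
  then show ?thesis by (simp add: P_def)
qed

lemma spanning_tripod_form:
  assumes s: "spanning_tripod c xs ys zs"
  defines "\<kappa> \<equiv> 1 / (real (length xs) + 1) + 1 / (real (length ys) + 1) + 1 / (real (length zs) + 1) - 1"
  obtains g where "\<And>v. g v \<ge> 0" "g c > 0" "\<And>f. (\<Sum>v\<in>verts Q. g v * cartan f v) = \<kappa> * f c"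
proof -
  define ls where "ls = [length xs, length ys, length zs]"
  define h where "h = (\<lambda>(i, j). (c # [xs, ys, zs] ! i) ! j)"
  have ne: "ls \<noteq> []" by (simp add: ls_def)
  obtain d where emb: "embedding (star_vertices ls) (star_edges ls)
      (\<lambda>(i, j). arm_vertex i j) (\<lambda>(i, j). arm_vertex i (j + 1)) h d"
    and surj: "d ` star_edges ls = arcs Q"
    by (rule spanning_tripod_embedding[OF s ls_def h_def])
  define g where "g = extend_zero (star_vertices ls) h (star_weight ls)"
  note E = emb[unfolded embedding_def]
  have "(\<Sum>v\<in>verts Q. g v * cartan f v) = \<kappa> * f c" for f
  proof -
    have "(\<Sum>v\<in>verts Q. g v * cartan f v) = (2 - (\<Sum>l\<leftarrow>ls. 1 - 1 / (real l + 1))) * f (h (0, 0))"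
      unfolding sum_extend_zero_mult_cartan[OF emb g_def] surj Diff_cancel sum.empty diff_0_right
        star_form[OF ne refl, of "\<lambda>p. f (h p)", unfolded case_prod_unfold, symmetric]
        case_prod_unfold ..
    moreover have "2 - (\<Sum>l\<leftarrow>ls. 1 - 1 / (real l + 1)) = \<kappa>" by (simp add: \<kappa>_def ls_def)
    moreover have "h (0, 0) = c" by (simp add: h_def)
    ultimately show ?thesis by simp
  qed
  moreover have gh: "g (h p) = star_weight ls p" if "p \<in> star_vertices ls" for p
    using E that by (auto simp: g_def extend_zero_def the_inv_into_f_f)
  have weight: "star_weight ls p \<ge> 0" if p: "p \<in> star_vertices ls" for p
  proof -
    obtain i j where "p = arm_vertex i j" "i < length ls" "j \<le> ls ! i"
      using p unfolding star_vertices_def by blast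
    then show ?thesis by (auto simp: star_weight_def arm_vertex_def divide_le_eq_1_pos)
  qed
  have "g v \<ge> 0" for v
  proof (cases "v \<in> h ` star_vertices ls")
    case True
    then obtain p where "p \<in> star_vertices ls" "v = h p" by blast
    then show ?thesis using weight gh by simp
  qed (simp add: g_def extend_zero_def)
  moreover have "g c > 0"
  proof -
    have "(0, 0) \<in> star_vertices ls" by (simp add: star_vertices_conv[OF ne])
    from gh[OF this] show ?thesis by (simp add: star_weight_def h_def)
  qed
  ultimately show ?thesis using that by blast
qed

text \<open>
  Testing against the star weight leaves the multiple \<open>\<kappa>\<close> of the single value \<open>f c\<close>. If \<open>f\<close> is
  strictly subadditive, it is positive; if \<open>f\<close> ranges over almost additive functions, it stays bounded
  while \<open>f c\<close> becomes arbitrarily large.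
\<close>
lemma spanning_tripod_reciprocals:
  assumes s: "spanning_tripod c xs ys zs"
  defines "\<kappa> \<equiv> 1 / (real (length xs) + 1) + 1 / (real (length ys) + 1) + 1 / (real (length zs) + 1) - 1"
  shows "strictly_subadditive \<Longrightarrow> \<kappa> > 0" and "almost_additive \<Longrightarrow> \<kappa> = 0"
proof -
  obtain g where g: "\<And>v. g v \<ge> 0" "g c > 0"
    and form: "\<And>f. (\<Sum>v\<in>verts Q. g v * cartan f v) = \<kappa> * f c"
    unfolding \<kappa>_def by (rule spanning_tripod_form[OF s]) blast
  have c: "c \<in> verts Q" using s by (simp add: spanning_tripod_def tripod_def)
  {
    assume ssa: "strictly_subadditive"
    obtain f where "\<And>v. v \<in> verts Q \<Longrightarrow> f v \<ge> 0" "(\<Sum>v\<in>verts Q. g v * cartan f v) > 0"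
      by (rule strictly_subadditive_test[of g c, OF ssa g(1) c g(2)]) blast
    then have "f c \<ge> 0" "\<kappa> * f c > 0" using c form by simp_all
    then show "\<kappa> > 0" by (simp add: zero_less_mult_iff)
  next
    assume aa: "almost_additive"
    show "\<kappa> = 0"
    proof (rule ccontr)
      assume "\<kappa> \<noteq> 0"
      define K where "K = (\<Sum>v\<in>verts Q. g v)"
      \<comment> \<open>The lower bound makes \<open>\<bar>\<kappa> * f c\<bar>\<close> exceed \<open>K\<close>, the bound for an almost additive function.\<close>
      obtain f where f: "\<And>v. v \<in> verts Q \<Longrightarrow> f v \<ge> (K + 1) / \<bar>\<kappa>\<bar>"
        and le: "\<bar>\<Sum>v\<in>verts Q. g v * cartan f v\<bar> \<le> K"
        unfolding K_def
        by (rule almost_additive_test[of g "((\<Sum>v\<in>verts Q. g v) + 1) / \<bar>\<kappa>\<bar>", OF aa g(1)]) blast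
      have "K + 1 \<le> \<bar>\<kappa>\<bar> * f c" using f[OF c] \<open>\<kappa> \<noteq> 0\<close>
        by (simp add: pos_divide_le_eq mult.commute)
      also have "\<dots> \<le> \<bar>\<kappa> * f c\<bar>" by (simp add: abs_mult mult_left_mono)
      finally show False using le form[of f] by simp
    qed
  }
qed

end


section \<open>Classification by sums of reciprocals\<close>

lemma reciprocal_sum_cleared:
  fixes a b c :: nat
  assumes "1 \<le> a" "1 \<le> b" "1 \<le> c"
  shows "(1 / real a + 1 / real b + 1 / real c) * real (a * b * c) = real (a * b + b * c + c * a)"
proof -
  have "real a \<noteq> 0" "real b \<noteq> 0" "real c \<noteq> 0" using assms by simp_all
  then show ?thesis by (simp add: distrib_right)
qed

lemma reciprocal_sum_gt_1:
  fixes a b c :: nat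
  assumes "1 \<le> a" "a \<le> b" "b \<le> c" and "1 / real a + 1 / real b + 1 / real c > 1"
  shows "a = 1 \<or> a = 2 \<and> b = 2 \<or> a = 2 \<and> b = 3 \<and> c \<in> {3, 4, 5}"
proof -
  have "1 * real (a * b * c) < (1 / real a + 1 / real b + 1 / real c) * real (a * b * c)"
    by (rule mult_strict_right_mono) (use assms in simp_all)
  also have "\<dots> = real (a * b + b * c + c * a)" using assms by (intro reciprocal_sum_cleared) simp_all
  finally have lt: "a * b * c < a * b + b * c + c * a" unfolding mult_1 of_nat_less_iff .
  have "a * b \<le> b * c" "c * a \<le> b * c" using assms by (simp_all add: mult.commute mult_le_mono)
  then have "a * (b * c) < 3 * (b * c)" using lt mult.assoc[of a b c] by linarith
  then have "a < 3" by simp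
  then consider "a = 1" | "a = 2" using assms(1) by linarith
  then show ?thesis
  proof cases
    case 2
    then have bc: "b * c < 2 * b + 2 * c" using lt by simp
    then have "b * c < 4 * c" using assms by linarith
    then have "b < 4" by simp
    then have "b = 2 \<or> b = 3" using assms 2 by linarith
    then show ?thesis using 2 bc assms by auto
  qed simp
qed

lemma reciprocal_sum_eq_1:
  fixes a b c :: nat
  assumes "1 \<le> a" "a \<le> b" "b \<le> c" and "1 / real a + 1 / real b + 1 / real c = 1"
  shows "(a, b, c) \<in> {(3, 3, 3), (2, 4, 4), (2, 3, 6)}"
proof -
  have "1 * real (a * b * c) = (1 / real a + 1 / real b + 1 / real c) * real (a * b * c)"
    unfolding assms(4) ..
  also have "\<dots> = real (a * b + b * c + c * a)" using assms by (intro reciprocal_sum_cleared) simp_all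
  finally have eq: "a * b * c = a * b + b * c + c * a" unfolding mult_1 of_nat_eq_iff .
  have "a * b \<le> b * c" "c * a \<le> b * c" using assms by (simp_all add: mult.commute mult_le_mono)
  then have "a * (b * c) \<le> 3 * (b * c)" using eq mult.assoc[of a b c] by linarith
  then have "a \<le> 3" using assms by simp
  then consider "a = 1" | "a = 2" | "a = 3" using assms(1) by linarith
  then show ?thesis
  proof cases
    case 1
    then show ?thesis using eq assms by simp
  next
    case 2
    then have bc: "b * c = 2 * b + 2 * c" using eq by simp
    then have "b * c \<le> 4 * c" using assms by linarith
    then have "b \<le> 4" using assms by simp
    then have "b = 2 \<or> b = 3 \<or> b = 4" using assms 2 by linarith
    then show ?thesis using 2 bc assms by auto
  next
    case 3
    then have bc: "2 * (b * c) = 3 * b + 3 * c" using eq by simp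
    then have "b * c \<le> 3 * c" using assms by linarith
    then have "b \<le> 3" using assms by simp
    then have "b = 3" using assms 3 by linarith
    then show ?thesis using 3 bc assms by auto
  qed
qed

context connected_multigraph
begin

theorem strictly_subadditive_imp_dynkin:
  assumes ssa: strictly_subadditive
  shows "dynkin_diagram (underlying_graph Q)"
proof -
  have "\<not> extended_case" using ssa by (simp add: extended_case_def)
  then obtain c xs ys zs where s: "spanning_tripod c xs ys zs"
    and le: "length xs \<le> length ys" "length ys \<le> length zs"
    by (rule extended_or_spanning_tripod)
  let ?a = "length xs + 1" and ?b = "length ys + 1" and ?c = "length zs + 1"
  have "1 / real ?a + 1 / real ?b + 1 / real ?c > 1"
    using spanning_tripod_reciprocals(1)[OF s ssa] by (simp add: add.commute)
  then have "?a = 1 \<or> ?a = 2 \<and> ?b = 2 \<or> ?a = 2 \<and> ?b = 3 \<and> ?c \<in> {3, 4, 5}"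
    by (rule reciprocal_sum_gt_1[rotated 3]) (use le in simp_all)
  then consider "xs = []" | "length xs = 1" "length ys = 1"
    | "length xs = 1" "length ys = 2" "length zs \<in> {2, 3, 4}"
    by auto
  then show ?thesis
  proof cases
    case 1
    then have "underlying_graph Q \<cong>\<^sub>M path_diagram (length ys + length zs + 1)"
      using spanning_tripod_iso_path s by simp
    then have "\<exists>n\<ge>1. underlying_graph Q \<cong>\<^sub>M path_diagram n"
      by (intro exI[of _ "length ys + length zs + 1"]) simp
    then show ?thesis unfolding dynkin_diagram_def by blast
  next
    case 2
    then have "underlying_graph Q \<cong>\<^sub>M star_diagram [1, 1, (length zs + 3) - 3]" "length zs + 3 \<ge> 4"
      using spanning_tripod_iso_star[OF s] le by auto
    then have "\<exists>n\<ge>4. underlying_graph Q \<cong>\<^sub>M star_diagram [1, 1, n - 3]" by blast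
    then show ?thesis unfolding dynkin_diagram_def by blast
  next
    case 3
    then show ?thesis using spanning_tripod_iso_star[OF s] unfolding dynkin_diagram_def by auto
  qed
qed

theorem almost_additive_imp_extended_dynkin:
  assumes aa: almost_additive
  shows "extended_dynkin_diagram (underlying_graph Q)"
proof (cases extended_case)
  case True
  then show ?thesis using aa by (simp add: extended_case_def)
next
  case False
  then obtain c xs ys zs where s: "spanning_tripod c xs ys zs"
    and le: "length xs \<le> length ys" "length ys \<le> length zs"
    by (rule extended_or_spanning_tripod)
  let ?a = "length xs + 1" and ?b = "length ys + 1" and ?c = "length zs + 1"
  have "1 / real ?a + 1 / real ?b + 1 / real ?c = 1"
    using spanning_tripod_reciprocals(2)[OF s aa] by (simp add: add.commute)
  then have "(?a, ?b, ?c) \<in> {(3, 3, 3), (2, 4, 4), (2, 3, 6)}"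
    by (rule reciprocal_sum_eq_1[rotated 3]) (use le in simp_all)
  then show ?thesis
    using spanning_tripod_iso_star[OF s] unfolding extended_dynkin_diagram_def by auto
qed

end


section \<open>Friezes\<close>

context acyclic_quiver
begin

lemma no_loop:
  assumes "e \<in> arcs Q"
  shows "tail Q e \<noteq> head Q e"
proof
  assume "tail Q e = head Q e"
  then have "cycle [e]" using assms arc_implies_awalk[OF assms]
    by (auto simp: cycle_def intro!: exI[of _ "tail Q e"])
  then show False using no_cycle by blast
qed

text \<open>
  Since all values are at least \<open>1\<close>, each factor of an exchange monomial of \<open>v\<close> is at most the product
  of two consecutive values at \<open>v\<close>.
\<close>
lemma Bseq_neighbours:
  assumes fr: "is_frieze Q a" and e: "e \<in> arcs Q"
  shows "Bseq (a (tail Q e)) \<longleftrightarrow> Bseq (a (head Q e))"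
proof -
  have Bseq_prod: "Bseq (\<lambda>n. s (Suc n) * s n)" if "Bseq s" for s :: "nat \<Rightarrow> real"
    using that by (intro Bseq_mult) (simp_all add: Bseq_Suc_iff)
  have dom: "Bseq s" if "Bseq t" "\<And>n. 0 \<le> s n" "\<And>n. s n \<le> t n" for s t :: "nat \<Rightarrow> real"
  proof -
    have "norm (s n) \<le> norm (t n)" for n using that(2)[of n] that(3)[of n] by simp
    then show ?thesis using Bseq_eventually_mono[of s t] that(1) by simp
  qed
  have nonneg: "0 \<le> a v n" if "v \<in> verts Q" for v n using frieze_pos[OF fr that, of n] by simp
  note tail = nonneg[OF tail_in_verts[OF e]] and head = nonneg[OF head_in_verts[OF e]]
  show ?thesis
  proof
    assume "Bseq (a (tail Q e))"
    from dom[OF Bseq_prod[OF this] head frieze_neighbour_le(2)[OF fr e]]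
    show "Bseq (a (head Q e))" .
  next
    assume "Bseq (a (head Q e))"
    from dom[OF Bseq_prod[OF this] tail frieze_neighbour_le(1)[OF fr e]]
    show "Bseq (a (tail Q e))" by (simp add: Bseq_Suc_iff)
  qed
qed

end

theorem theorem9p1:
  fixes Q :: "('v, 'e) pre_digraph" and a :: "'v \<Rightarrow> nat \<Rightarrow> real"
  assumes "acyclic_quiver Q"
    and "Digraph_Component.connected Q"
    and "is_frieze Q a"
  shows "((\<forall>v\<in>verts Q. Bseq (a v)) \<or> (\<forall>v\<in>verts Q. \<not> Bseq (a v)))
    \<and> (rational_frieze Q a \<longrightarrow>
         ((\<forall>v\<in>verts Q. Bseq (a v)) \<longrightarrow> dynkin_diagram (underlying_graph Q))
         \<and> ((\<forall>v\<in>verts Q. \<not> Bseq (a v)) \<longrightarrow> extended_dynkin_diagram (underlying_graph Q)))"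
proof (intro conjI impI)
  interpret acyclic_quiver Q by fact
  interpret connected_multigraph Q
    by (unfold_locales; (rule assms(2) | rule no_loop))
  show "(\<forall>v\<in>verts Q. Bseq (a v)) \<or> (\<forall>v\<in>verts Q. \<not> Bseq (a v))"
  proof (rule disjCI)
    assume "\<not> (\<forall>v\<in>verts Q. \<not> Bseq (a v))"
    then have ne: "{v \<in> verts Q. Bseq (a v)} \<noteq> {}" by blast
    have "{v \<in> verts Q. Bseq (a v)} = verts Q"
    proof (rule adjacent_closed_imp_all[OF _ ne])
      fix u v assume u: "u \<in> {v \<in> verts Q. Bseq (a v)}" and uv: "adjacent u v"
      obtain e where e: "e \<in> arcs Q" "{tail Q e, head Q e} = {u, v}"
        using uv unfolding adjacent_def ends_def by blast
      have "Bseq (a v)"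
        using u e(2) Bseq_neighbours[OF assms(3) e(1)] unfolding doubleton_eq_iff by blast
      then show "v \<in> {v \<in> verts Q. Bseq (a v)}" using adjacent_in_verts[OF uv] by simp
    qed blast
    then show "\<forall>v\<in>verts Q. Bseq (a v)" by blast
  qed
  show "dynkin_diagram (underlying_graph Q)" if "\<forall>v\<in>verts Q. Bseq (a v)"
    using bounded_frieze_imp_strictly_subadditive[OF assms(3) that]
    by (intro strictly_subadditive_imp_dynkin) (simp add: strictly_subadditive_def)
  show "extended_dynkin_diagram (underlying_graph Q)"
    if "rational_frieze Q a" "\<forall>v\<in>verts Q. \<not> Bseq (a v)"
    using unbounded_rational_frieze_imp_almost_additive[OF assms(3) that]
    by (intro almost_additive_imp_extended_dynkin) (simp add: almost_additive_def)
qed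

end
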